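(* Let $r\in\mathbb{N}_0$ be fixed, and let $E_{n;r}$ and $V_{n;r}$ denote the expectation and variance of the number of $r$-branches of a binary tree chosen uniformly at random among all binary trees with $n$ inner nodes. Then, as $n\to\infty$, \[ E_{n;r}=\frac{n}{4^r}+\frac16\Big(1+\frac{5}{4^r}\Big)+\frac{1}{20n}\Big(4^r-\frac{1}{4^r}\Big)+\frac{1}{12n^2}\Big(\frac{5\cdot16^r}{21}-\frac{7\cdot4^r}{10}+\frac{97}{210\cdot4^r}\Big)+O(n^{-3}), \] \[ V_{n;r}=\frac{4^r-1}{3\cdot16^r}\,n-\frac{2\cdot16^r-25\cdot4^r+23}{90\cdot16^r}-\frac{13\cdot64^r-14\cdot16^r+7\cdot4^r-6}{420\cdot16^r\,n}+O(n^{-2}). \]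
   Context: A binary tree is either a leaf $\square$ or an inner node with an ordered pair of subtrees (left, right) which are binary trees; its size is its number of inner nodes. The register function is defined by $\mathrm{Reg}(\square)=0$, and for a tree with subtrees $t_1,t_2$: $\mathrm{Reg}(t)=\max\{\mathrm{Reg}(t_1),\mathrm{Reg}(t_2)\}$ if these differ, and $\mathrm{Reg}(t_1)+1$ otherwise. Label every node (inner node or leaf) of a tree $t$ by the register function of the subtree rooted at it. An $r$-branch of $t$ is a maximal chain of nodes labeled $r$, i.e. a connected component (with respect to the parent–child edges) of the set of nodes labeled $r$; such a component is always a path going downward from a node. The nodes of $t$ are partitioned into $r$-branches, $r\ge0$. *)

theory Defs
  imports Complex_Main "HOL-Library.Landau_Symbols"
begin

datatype bt = Leaf | Node bt bt

fun inner_nodes :: "bt \<Rightarrow> nat" where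
  "inner_nodes Leaf = 0"
| "inner_nodes (Node l r) = inner_nodes l + inner_nodes r + 1"

fun Reg :: "bt \<Rightarrow> nat" where
  "Reg Leaf = 0"
| "Reg (Node t1 t2) = (if Reg t1 \<noteq> Reg t2 then max (Reg t1) (Reg t2) else Reg t1 + 1)"

text \<open>Nodes (inner nodes and leaves) of a tree are addressed by their path from the root
  (False = go left, True = go right).\<close>
fun positions :: "bt \<Rightarrow> bool list set" where
  "positions Leaf = {[]}"
| "positions (Node l r) = insert [] ((Cons False) ` positions l \<union> (Cons True) ` positions r)"

fun subtree_at :: "bt \<Rightarrow> bool list \<Rightarrow> bt" where
  "subtree_at t [] = t"
| "subtree_at (Node l r) (False # p) = subtree_at l p"
| "subtree_at (Node l r) (True # p) = subtree_at r p"
| "subtree_at Leaf (b # p) = Leaf"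

definition label :: "bt \<Rightarrow> bool list \<Rightarrow> nat" where
  "label t p = Reg (subtree_at t p)"

definition r_nodes :: "nat \<Rightarrow> bt \<Rightarrow> bool list set" where
  "r_nodes r t = {p \<in> positions t. label t p = r}"

definition r_edges :: "nat \<Rightarrow> bt \<Rightarrow> (bool list \<times> bool list) set" where
  "r_edges r t = {(p, q). p \<in> r_nodes r t \<and> q \<in> r_nodes r t \<and>
                    (\<exists>b. q = p @ [b] \<or> p = q @ [b])}"

definition r_conn :: "nat \<Rightarrow> bt \<Rightarrow> (bool list \<times> bool list) set" where
  "r_conn r t = Id_on (r_nodes r t) \<union> (r_edges r t)\<^sup>+"

definition r_branches :: "nat \<Rightarrow> bt \<Rightarrow> bool list set set" where
  "r_branches r t = r_nodes r t // r_conn r t"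

definition num_branches :: "nat \<Rightarrow> bt \<Rightarrow> nat" where
  "num_branches r t = card (r_branches r t)"

definition trees :: "nat \<Rightarrow> bt set" where
  "trees n = {t. inner_nodes t = n}"

definition E_branches :: "nat \<Rightarrow> nat \<Rightarrow> real" where
  "E_branches n r = (\<Sum>t\<in>trees n. real (num_branches r t)) / real (card (trees n))"

definition V_branches :: "nat \<Rightarrow> nat \<Rightarrow> real" where
  "V_branches n r = (\<Sum>t\<in>trees n. (real (num_branches r t) - E_branches n r)^2)
                     / real (card (trees n))"

end

theory Submission
  imports Defs "HOL-Computational_Algebra.Formal_Power_Series" "HOL-Real_Asymp.Real_Asymp"
begin

unbundle fps_syntax

text \<open>
  Deleting all leaves of a tree and contracting the unary nodes lowers every register label by one,
  so the \<open>(r + 1)\<close>-branches of a tree are the \<open>r\<close>-branches of its reduction. The trees that reduce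
  to a given tree of size \<open>j\<close> have generating function \<open>(X / (1 - 2 X))\<^bsup>2j+1\<^esup>\<close>; hence the
  generating functions of the mean and of the second factorial moment for \<open>r + 1\<close> arise from those
  for \<open>r\<close> by the operator \<open>f \<mapsto> y f(y\<^sup>2)\<close> with \<open>y = X / (1 - 2 X)\<close>.

  Put \<open>x = 1 - 4 X\<close> and \<open>D = x\<^bsup>-1/2\<^esup>\<close>. For \<open>r = 0\<close> the two moments are \<open>D\<close> and \<open>(D / x - D) / 2\<close>,
  and the operator maps \<open>D x\<^bsup>i\<^esup>\<close> to \<open>X D x\<^bsup>i\<^esup> (1 - 2 X)\<^bsup>-2i\<^esup>\<close>, which is again a combination of
  \<open>D x\<^bsup>i\<^esup>, D x\<^bsup>i+1\<^esup>, \<dots>\<close> because \<open>X = (1 - x) / 4\<close> and \<open>1 - 2 X = (1 + x) / 2\<close>. So it acts on truncated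
  expansions in \<open>x\<close> by a triangular matrix with eigenvalues \<open>4\<^bsup>i-1\<^esup>\<close>, and the coefficients for general
  \<open>r\<close> follow by induction. Remainders with coefficients \<open>O(4\<^sup>n / n\<^sup>5)\<close> are preserved, by an elementary
  estimate with binomial sums. Finally the \<open>n\<close>-th coefficient of \<open>D x\<^bsup>i\<^esup>\<close> divided by the \<open>n\<close>-th
  Catalan number is a rational function of \<open>n\<close>.
\<close>

subsection \<open>Counting branches by their topmost nodes\<close>

text \<open>\<open>butlast p\<close> is the parent of \<open>p\<close>. The root needs its own case
  because \<open>butlast [] = []\<close>.\<close>

definition branch_tops :: "nat \<Rightarrow> bt \<Rightarrow> bool list set" where
  "branch_tops r t = {p \<in> r_nodes r t. p = [] \<or> butlast p \<notin> r_nodes r t}"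

lemma Nil_in_positions [simp]: "[] \<in> positions t"
  by (cases t) auto

lemma finite_positions [simp]: "finite (positions t)"
  by (induction t) auto

lemma equiv_r_conn: "equiv (r_nodes r t) (r_conn r t)"
proof -
  have "r_edges r t \<subseteq> r_nodes r t \<times> r_nodes r t"
    by (auto simp: r_edges_def)
  then have sub: "(r_edges r t)\<^sup>+ \<subseteq> r_nodes r t \<times> r_nodes r t"
    by (rule trancl_subset_Sigma)
  have "sym (r_edges r t)"
    by (auto simp: r_edges_def sym_def)
  then have "sym ((r_edges r t)\<^sup>+)"
    by (rule sym_trancl)
  moreover have "trans (r_conn r t)"
    unfolding r_conn_def trans_def using sub by (auto intro: trancl_trans)
  ultimately show ?thesis
    using sub unfolding r_conn_def
    by (auto simp: equiv_def refl_on_def sym_def)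
qed

text \<open>Climb towards the root: if the parent is labelled \<open>r\<close>, the top found for it
  serves; otherwise the node is itself a top.\<close>

lemma ex_branch_top:
  "p \<in> r_nodes r t \<Longrightarrow> \<exists>q \<in> branch_tops r t. (q, p) \<in> r_conn r t"
proof (induction p rule: rev_induct)
  case Nil
  then show ?case
    by (auto simp: branch_tops_def r_conn_def)
next
  case (snoc b p)
  show ?case
  proof (cases "p \<in> r_nodes r t")
    case True
    then obtain q where q: "q \<in> branch_tops r t" "(q, p) \<in> r_conn r t"
      using snoc.IH by blast
    have "(p, p @ [b]) \<in> r_conn r t"
      using True snoc.prems by (auto simp: r_conn_def r_edges_def)
    then show ?thesis
      using q equiv_r_conn[of r t] by (meson equivE transE)
  next
    case False
    then show ?thesis
      using snoc.prems by (auto simp: branch_tops_def r_conn_def)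
  qed
qed

text \<open>An invariant of walks starting in \<open>p\<close>: the only step that could leave the subtree at \<open>p\<close> is
  the one from \<open>p\<close> to its parent, which is not labelled \<open>r\<close>.\<close>

lemma r_conn_top_below:
  assumes p: "p \<in> branch_tops r t" and "(p, q) \<in> r_conn r t"
  shows "\<exists>ds. q = p @ ds \<and> (\<forall>k \<le> length ds. p @ take k ds \<in> r_nodes r t)"
proof -
  have "\<exists>ds. q = p @ ds \<and> (\<forall>k \<le> length ds. p @ take k ds \<in> r_nodes r t)"
    if "(p, q) \<in> (r_edges r t)\<^sup>*" for q
    using that
  proof (induction rule: rtrancl_induct)
    case base
    then show ?case
      using p by (auto simp: branch_tops_def)
  next
    case (step q q')
    then obtain ds where ds: "q = p @ ds" "\<forall>k \<le> length ds. p @ take k ds \<in> r_nodes r t"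
      by blast
    from step.hyps(2) consider (down) b where "q' = q @ [b]" | (up) b where "q = q' @ [b]"
      by (auto simp: r_edges_def)
    then show ?case
    proof cases
      case down
      with step.hyps(2) ds have "p @ ds @ [b] \<in> r_nodes r t"
        by (auto simp: r_edges_def)
      with ds(2) have "\<forall>k \<le> length (ds @ [b]). p @ take k (ds @ [b]) \<in> r_nodes r t"
        by (auto simp: le_Suc_eq)
      with down ds(1) show ?thesis
        by (intro exI[of _ "ds @ [b]"]) auto
    next
      case up
      show ?thesis
      proof (cases ds rule: rev_cases)
        case Nil
        with up ds(1) have "p = q' @ [b]" by simp
        moreover have "q' \<in> r_nodes r t"
          using step.hyps(2) by (auto simp: r_edges_def)
        ultimately show ?thesis
          using p by (auto simp: branch_tops_def)
      next
        case (snoc ds' b')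
        have "p @ take k ds' \<in> r_nodes r t" if "k \<le> length ds'" for k
          using ds(2)[rule_format, of k] that snoc by auto
        with snoc up ds(1) show ?thesis
          by auto
      qed
    qed
  qed
  moreover have "(p, q) \<in> (r_edges r t)\<^sup>*"
    using assms(2) by (auto simp: r_conn_def)
  ultimately show ?thesis
    by blast
qed

text \<open>Sending a top to its class is a bijection onto the branches: every class contains a top
  by climbing, and two tops in one class coincide because everything connected to a top lies below
  it along nodes labelled \<open>r\<close>.\<close>

lemma num_branches_eq_card_tops: "num_branches r t = card (branch_tops r t)"
proof -
  have "bij_betw (\<lambda>p. r_conn r t `` {p}) (branch_tops r t) (r_branches r t)"
    unfolding bij_betw_def
  proof
    show "inj_on (\<lambda>p. r_conn r t `` {p}) (branch_tops r t)"
    proof (rule inj_onI)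
      fix p q
      assume p: "p \<in> branch_tops r t" and q: "q \<in> branch_tops r t"
        and "r_conn r t `` {p} = r_conn r t `` {q}"
      then have "(p, q) \<in> r_conn r t"
        using eq_equiv_class[OF _ equiv_r_conn] by (auto simp: branch_tops_def)
      then obtain ds where ds: "q = p @ ds" "\<forall>k \<le> length ds. p @ take k ds \<in> r_nodes r t"
        using r_conn_top_below[OF p] by blast
      show "p = q"
      proof (cases ds rule: rev_cases)
        case (snoc ds' b)
        \<comment> \<open>Dropping the last step of \<open>ds\<close> leads to the parent of
          \<open>q\<close>, so this parent is labelled \<open>r\<close>, against \<open>q\<close>
          being a top.\<close>
        with ds(2)[rule_format, of "length ds'"] ds(1) have "butlast q \<in> r_nodes r t" "q \<noteq> []"
          by (auto simp: butlast_append)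
        with q show ?thesis
          by (auto simp: branch_tops_def)
      qed (use ds in auto)
    qed
    show "(\<lambda>p. r_conn r t `` {p}) ` branch_tops r t = r_branches r t"
    proof (intro equalityI subsetI)
      fix C assume "C \<in> r_branches r t"
      then obtain p where p: "p \<in> r_nodes r t" "C = r_conn r t `` {p}"
        by (auto simp: r_branches_def quotient_def)
      with ex_branch_top[OF p(1)] show "C \<in> (\<lambda>p. r_conn r t `` {p}) ` branch_tops r t"
        using equiv_class_eq[OF equiv_r_conn] by blast
    qed (auto simp: r_branches_def quotient_def branch_tops_def)
  qed
  then show ?thesis
    using bij_betw_same_card by (fastforce simp: num_branches_def)
qed

section \<open>Recursion of the branch count at the root\<close>

lemma r_nodes_Node:
  "r_nodes r (Node a b) = {p. p = [] \<and> Reg (Node a b) = r} \<union>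
     Cons False ` r_nodes r a \<union> Cons True ` r_nodes r b"
  by (auto simp: r_nodes_def label_def)

text \<open>The tops of the subtrees stay tops, except that the root of a subtree is no longer one
  if the new root above it is labelled \<open>r\<close>.\<close>

lemma branch_tops_Node:
  "branch_tops r (Node a b) = {p. p = [] \<and> Reg (Node a b) = r} \<union>
     Cons False ` {p \<in> branch_tops r a. p = [] \<longrightarrow> Reg (Node a b) \<noteq> r} \<union>
     Cons True ` {p \<in> branch_tops r b. p = [] \<longrightarrow> Reg (Node a b) \<noteq> r}"
  unfolding branch_tops_def r_nodes_Node
  by (auto simp del: Reg.simps split: if_splits)

lemma Nil_in_branch_tops: "[] \<in> branch_tops r t \<longleftrightarrow> Reg t = r"
  by (auto simp: branch_tops_def r_nodes_def label_def)

lemma finite_branch_tops [simp]: "finite (branch_tops r t)"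
  by (rule finite_subset[of _ "positions t"]) (auto simp: branch_tops_def r_nodes_def)

lemma num_branches_Leaf: "num_branches r Leaf = (if r = 0 then 1 else 0)"
proof -
  have "branch_tops r Leaf = (if r = 0 then {[]} else {})"
    by (auto simp: branch_tops_def r_nodes_def label_def)
  then show ?thesis
    by (simp add: num_branches_eq_card_tops)
qed

text \<open>The root begins a new branch only if its label exceeds both child labels, that is, if
  these are equal. Otherwise it prolongs the branch of the child with the larger label.\<close>

lemma num_branches_Node:
  "num_branches r (Node a b) =
     num_branches r a + num_branches r b + (if Reg a = Reg b \<and> Suc (Reg a) = r then 1 else 0)"
proof -
  define R where "R = Reg (Node a b)"
  define N where "N = (\<lambda>c. {p \<in> branch_tops r c. p = [] \<longrightarrow> R \<noteq> r})"
  have N: "N c = (if R = r \<and> Reg c = r then branch_tops r c - {[]} else branch_tops r c)" for c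
    unfolding N_def by (auto simp: Nil_in_branch_tops)
  have fin: "finite (N c)" for c
    by (simp add: N)
  \<comment> \<open>Counting in \<open>int\<close> makes the removal of \<open>[]\<close> a true
    subtraction.\<close>
  have card_N: "int (card (N c)) = int (num_branches r c) - (if R = r \<and> Reg c = r then 1 else 0)"
    for c
  proof -
    have "card (branch_tops r c) > 0" if "Reg c = r"
      using that Nil_in_branch_tops[of r c] by (auto simp: card_gt_0_iff)
    then show ?thesis
      by (auto simp: N num_branches_eq_card_tops Nil_in_branch_tops of_nat_diff)
  qed
  have "card (branch_tops r (Node a b)) =
      (if R = r then 1 else 0) + card (Cons False ` N a) + card (Cons True ` N b)"
  proof -
    have "branch_tops r (Node a b) = (if R = r then {[]} else {}) \<union> (Cons False ` N a \<union> Cons True ` N b)"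
      unfolding branch_tops_Node N_def R_def by auto
    also have "card \<dots> = card (if R = r then {[]} else {} :: bool list set) +
        card (Cons False ` N a \<union> Cons True ` N b)"
      by (rule card_Un_disjoint) (auto simp: fin)
    also have "card (Cons False ` N a \<union> Cons True ` N b) =
        card (Cons False ` N a) + card (Cons True ` N b)"
      by (rule card_Un_disjoint) (auto simp: fin)
    finally show ?thesis
      by simp
  qed
  then have "int (num_branches r (Node a b)) =
      (if R = r then 1 else 0) + int (card (N a)) + int (card (N b))"
    by (simp add: num_branches_eq_card_tops card_image)
  then show ?thesis
    unfolding card_N by (auto simp: R_def max_def split: if_splits)
qed

subsection \<open>Removing the leaves\<close>

text \<open>The value at \<open>Leaf\<close> is junk.\<close>

fun reduce :: "bt \<Rightarrow> bt" where
  "reduce Leaf = Leaf"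
| "reduce (Node Leaf b) = reduce b"
| "reduce (Node a Leaf) = reduce a"
| "reduce (Node a b) = Node (reduce a) (reduce b)"

lemma reduce_Node:
  "reduce (Node a b) = (if a = Leaf then reduce b else if b = Leaf then reduce a
     else Node (reduce a) (reduce b))"
  by (cases a; cases b) auto

lemma Reg_eq_0_iff [simp]: "Reg t = 0 \<longleftrightarrow> t = Leaf"
  by (induction t) auto

text \<open>A node with exactly one leaf child inherits the positive label of the other child, so
  contracting it changes no label. A node with two leaf children has label 1 and becomes a
  leaf.\<close>

lemma Reg_reduce: "t \<noteq> Leaf \<Longrightarrow> Reg t = Suc (Reg (reduce t))"
proof (induction t)
  case (Node a b)
  then show ?case
    by (cases "a = Leaf"; cases "b = Leaf") (auto simp: reduce_Node)
qed simp

text \<open>By \<open>Reg_reduce\<close> the condition for a new branch at the root is merely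
  shifted by one. The case \<open>t = Leaf\<close> is separate: a leaf has no branch of positive
  label, but as a reduced tree it would count as one 0-branch.\<close>

lemma num_branches_Suc:
  "num_branches (Suc r) t = (if t = Leaf then 0 else num_branches r (reduce t))"
proof (induction t)
  case (Node a b)
  then show ?case
    by (cases "a = Leaf"; cases "b = Leaf")
      (auto simp: reduce_Node num_branches_Node num_branches_Leaf Reg_reduce)
qed (simp add: num_branches_Leaf)

text \<open>Only leaves are labelled 0, and each of them is a branch of its own.\<close>

lemma num_branches_0: "num_branches 0 t = inner_nodes t + 1"
  by (induction t) (auto simp: num_branches_Leaf num_branches_Node)

text \<open>Guarantees that sums over reduced trees of size at most \<open>n\<close> reach the
  reductions of all trees of size \<open>n\<close>.\<close>

lemma inner_nodes_reduce: "inner_nodes (reduce t) \<le> inner_nodes t"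
  by (induction t) (auto simp: reduce_Node)

subsection \<open>Generating functions of weighted trees\<close>

lemma trees_0: "trees 0 = {Leaf}"
proof -
  have "inner_nodes t = 0 \<longleftrightarrow> t = Leaf" for t
    by (cases t) auto
  then show ?thesis
    by (auto simp: trees_def)
qed

lemma trees_Suc:
  "trees (Suc n) = (\<Union>i\<in>{0..n}. (\<lambda>(a, b). Node a b) ` (trees i \<times> trees (n - i)))"
proof (intro equalityI subsetI)
  fix t assume "t \<in> trees (Suc n)"
  then obtain a b where "t = Node a b" "inner_nodes a + inner_nodes b = n"
    by (cases t) (auto simp: trees_def)
  then show "t \<in> (\<Union>i\<in>{0..n}. (\<lambda>(a, b). Node a b) ` (trees i \<times> trees (n - i)))"
    by (auto simp: trees_def intro!: bexI[of _ "inner_nodes a"])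
qed (auto simp: trees_def)

lemma finite_trees [simp]: "finite (trees n)"
proof (induction n rule: less_induct)
  case (less n)
  show ?case
    using less by (cases n) (auto simp: trees_0 trees_Suc)
qed

lemma sum_trees_Suc:
  "(\<Sum>t\<in>trees (Suc n). w t) = (\<Sum>i=0..n. \<Sum>a\<in>trees i. \<Sum>b\<in>trees (n - i). w (Node a b))"
proof -
  have "(\<Sum>t\<in>trees (Suc n). w t) =
      (\<Sum>i=0..n. \<Sum>t\<in>(\<lambda>(a, b). Node a b) ` (trees i \<times> trees (n - i)). w t)"
    unfolding trees_Suc by (rule sum.UNION_disjoint) (auto, auto simp: trees_def)
  also have "\<dots> = (\<Sum>i=0..n. \<Sum>(a, b)\<in>trees i \<times> trees (n - i). w (Node a b))"
    by (intro sum.cong refl, subst sum.reindex) (auto simp: inj_on_def case_prod_unfold)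
  also have "\<dots> = (\<Sum>i=0..n. \<Sum>a\<in>trees i. \<Sum>b\<in>trees (n - i). w (Node a b))"
    by (simp add: sum.cartesian_product)
  finally show ?thesis .
qed

definition tree_gf :: "(bt \<Rightarrow> real) \<Rightarrow> real fps" where
  "tree_gf w = Abs_fps (\<lambda>n. \<Sum>t\<in>trees n. w t)"

lemma tree_gf_nth: "tree_gf w $ n = (\<Sum>t\<in>trees n. w t)"
  by (simp add: tree_gf_def)

lemma tree_gf_add: "tree_gf (\<lambda>t. w t + w' t) = tree_gf w + tree_gf w'"
  by (rule fps_ext) (simp add: tree_gf_nth sum.distrib)

lemma tree_gf_Leaf: "tree_gf (\<lambda>t. of_bool (t = Leaf)) = 1"
proof (rule fps_ext)
  fix n
  have "Leaf \<notin> trees n" if "n > 0"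
    using that by (auto simp: trees_def)
  then show "tree_gf (\<lambda>t. of_bool (t = Leaf)) $ n = 1 $ n"
    by (cases "n = 0") (auto simp: tree_gf_nth trees_0 intro!: sum.neutral)
qed

fun node_weight :: "(bt \<Rightarrow> real) \<Rightarrow> (bt \<Rightarrow> real) \<Rightarrow> bt \<Rightarrow> real" where
  "node_weight u v Leaf = 0"
| "node_weight u v (Node a b) = u a * v b"

text \<open>Splitting at the root gives a Cauchy product; the factor \<open>fps_X\<close> accounts
  for the root.\<close>

lemma tree_gf_node_weight: "tree_gf (node_weight u v) = fps_X * (tree_gf u * tree_gf v)"
proof (rule fps_ext)
  fix n
  show "tree_gf (node_weight u v) $ n = (fps_X * (tree_gf u * tree_gf v)) $ n"
  proof (cases n)
    case (Suc m)
    have "tree_gf (node_weight u v) $ Suc m = (tree_gf u * tree_gf v) $ m"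
      by (simp add: tree_gf_nth sum_trees_Suc fps_mult_nth sum_product)
    then show ?thesis
      unfolding Suc by (simp only: fps_X_mult_nth) simp
  qed (simp add: tree_gf_nth trees_0)
qed

definition catalan_gf :: "real fps" where
  "catalan_gf = tree_gf (\<lambda>_. 1)"

lemma catalan_gf_nth: "catalan_gf $ n = real (card (trees n))"
  by (simp add: catalan_gf_def tree_gf_nth)

lemma catalan_gf_eq: "catalan_gf = 1 + fps_X * catalan_gf ^ 2"
proof -
  have "1 = of_bool (t = Leaf) + node_weight (\<lambda>_. 1) (\<lambda>_. 1) t" for t
    by (cases t) auto
  then have "catalan_gf = tree_gf (\<lambda>t. of_bool (t = Leaf) + node_weight (\<lambda>_. 1) (\<lambda>_. 1) t)"
    unfolding catalan_gf_def by presburger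
  also have "\<dots> = 1 + fps_X * catalan_gf ^ 2"
    unfolding tree_gf_add tree_gf_Leaf tree_gf_node_weight catalan_gf_def by (simp add: power2_eq_square)
  finally show ?thesis .
qed

section \<open>Fibres of the reduction\<close>

definition geom2 :: "real fps" where
  "geom2 = inverse (1 - 2 * fps_X)"

lemma geom2_mult: "geom2 * (1 - 2 * fps_X) = 1"
  unfolding geom2_def by (rule inverse_mult_eq_1) simp

text \<open>A tree reducing to \<open>s\<close> arises by replacing each of the
  \<open>2 * inner_nodes s + 1\<close> nodes of \<open>s\<close> by a chain of contracted nodes,
  each with its leaf on the left or on the right (\<open>geom2\<close>), that ends in one further
  inner node (\<open>fps_X\<close>): a branching node for an inner node of \<open>s\<close>, a node
  with two leaves for a leaf of \<open>s\<close>.\<close>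

lemma tree_gf_reduce:
  "tree_gf (\<lambda>t. of_bool (t \<noteq> Leaf \<and> reduce t = s)) = (fps_X * geom2) ^ (2 * inner_nodes s + 1)"
proof -
  define leaf :: "bt \<Rightarrow> real" where "leaf = (\<lambda>t. of_bool (t = Leaf))"
  define w :: "bt \<Rightarrow> bt \<Rightarrow> real" where "w = (\<lambda>s t. of_bool (t \<noteq> Leaf \<and> reduce t = s))"
  have gf_leaf: "tree_gf leaf = 1"
    unfolding leaf_def by (rule tree_gf_Leaf)
  \<comment> \<open>The two terms \<open>fps_X * P\<close> stand for the trees whose root has a leaf
    on the left or on the right; solving the linear equation for \<open>P\<close> produces the
    factor \<open>geom2\<close>.\<close>
  have solve: "P = fps_X * geom2 * Q" if "P = fps_X * Q + (fps_X * P + fps_X * P)" for P Q :: "real fps"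
  proof -
    from that have P: "P * (1 - 2 * fps_X) = fps_X * Q"
      by (simp add: algebra_simps)
    have "P = P * (geom2 * (1 - 2 * fps_X))"
      by (simp add: geom2_mult)
    also have "\<dots> = geom2 * (P * (1 - 2 * fps_X))"
      by (simp only: mult_ac)
    finally show ?thesis
      unfolding P by (simp only: mult_ac)
  qed
  have "tree_gf (w s) = (fps_X * geom2) ^ (2 * inner_nodes s + 1)"
  proof (induction s)
    case Leaf
    \<comment> \<open>\<open>w Leaf\<close> vanishes at \<open>Leaf\<close>, so the node with two
      leaves is counted by the first summand only.\<close>
    have w: "w Leaf t = node_weight leaf leaf t +
        (node_weight leaf (w Leaf) t + node_weight (w Leaf) leaf t)" for t
      by (cases t) (auto simp: w_def leaf_def reduce_Node)
    have "tree_gf (w Leaf) = tree_gf (\<lambda>t. node_weight leaf leaf t +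
        (node_weight leaf (w Leaf) t + node_weight (w Leaf) leaf t))"
      by (rule arg_cong[of _ _ tree_gf], rule ext, rule w)
    then have "tree_gf (w Leaf) = fps_X * 1 + (fps_X * tree_gf (w Leaf) + fps_X * tree_gf (w Leaf))"
      unfolding tree_gf_add tree_gf_node_weight gf_leaf by simp
    from solve[OF this] show ?case
      by simp
  next
    case (Node c d)
    have w: "w (Node c d) t = node_weight (w c) (w d) t +
        (node_weight leaf (w (Node c d)) t + node_weight (w (Node c d)) leaf t)" for t
      by (cases t) (auto simp: w_def leaf_def reduce_Node)
    have "tree_gf (w (Node c d)) = tree_gf (\<lambda>t. node_weight (w c) (w d) t +
        (node_weight leaf (w (Node c d)) t + node_weight (w (Node c d)) leaf t))"
      by (rule arg_cong[of _ _ tree_gf], rule ext, rule w)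
    then have "tree_gf (w (Node c d)) = fps_X * (tree_gf (w c) * tree_gf (w d)) +
        (fps_X * tree_gf (w (Node c d)) + fps_X * tree_gf (w (Node c d)))"
      unfolding tree_gf_add tree_gf_node_weight gf_leaf by simp
    from solve[OF this] show ?case
      unfolding Node.IH by (simp add: power_add algebra_simps)
  qed
  then show ?thesis
    by (simp add: w_def)
qed

definition lift_gf :: "real fps \<Rightarrow> real fps" where
  "lift_gf f = fps_X * geom2 * (f oo (fps_X * geom2)\<^sup>2)"

lemma lift_gf_nth: "lift_gf f $ n = (\<Sum>j=0..n. f $ j * (fps_X * geom2) ^ (2 * j + 1) $ n)"
proof -
  let ?y = "fps_X * geom2"
  \<comment> \<open>The powers beyond \<open>m\<close> contribute 0 because \<open>?y\<close> has
    constant term 0. A range that does not depend on \<open>m\<close> allows the sums to be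
    exchanged.\<close>
  have comp: "(f oo ?y\<^sup>2) $ m = (\<Sum>j=0..n. f $ j * (?y\<^sup>2) ^ j $ m)" if "m \<le> n" for m
    unfolding fps_compose_nth
  proof (rule sum.mono_neutral_left)
    show "\<forall>j\<in>{0..n} - {0..m}. f $ j * (?y\<^sup>2) ^ j $ m = 0"
      by (auto intro!: startsby_zero_power_prefix[rule_format])
  qed (use that in auto)
  have "lift_gf f $ n = (\<Sum>i=0..n. ?y $ i * (f oo ?y\<^sup>2) $ (n - i))"
    unfolding lift_gf_def by (rule fps_mult_nth)
  also have "\<dots> = (\<Sum>i=0..n. \<Sum>j=0..n. f $ j * (?y $ i * (?y\<^sup>2) ^ j $ (n - i)))"
    by (intro sum.cong refl, subst comp) (auto simp: sum_distrib_left algebra_simps)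
  also have "\<dots> = (\<Sum>j=0..n. f $ j * (\<Sum>i=0..n. ?y $ i * (?y\<^sup>2) ^ j $ (n - i)))"
    by (subst sum.swap) (simp add: sum_distrib_left)
  also have "\<dots> = (\<Sum>j=0..n. f $ j * (?y * (?y\<^sup>2) ^ j) $ n)"
    by (simp only: fps_mult_nth[of ?y])
  finally show ?thesis
    by (simp add: power_mult)
qed

text \<open>Group the trees by their reduction. The tree \<open>Leaf\<close> lies in no fibre and
  has no branch of positive label, so \<open>\<phi> 0 = 0\<close> makes its contribution
  vanish.\<close>

lemma tree_gf_num_branches_Suc:
  fixes \<phi> :: "nat \<Rightarrow> real"
  assumes "\<phi> 0 = 0"
  shows "tree_gf (\<lambda>t. \<phi> (num_branches (Suc r) t)) = lift_gf (tree_gf (\<lambda>t. \<phi> (num_branches r t)))"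
proof (rule fps_ext)
  fix n
  have "\<phi> (num_branches (Suc r) t) =
      (\<Sum>j=0..n. \<Sum>s\<in>trees j. \<phi> (num_branches r s) * of_bool (t \<noteq> Leaf \<and> reduce t = s))"
    if "t \<in> trees n" for t
  proof (cases "t = Leaf")
    case False
    have "(\<Sum>j=0..n. \<Sum>s\<in>trees j. \<phi> (num_branches r s) * of_bool (t \<noteq> Leaf \<and> reduce t = s)) =
        (\<Sum>j=0..n. if j = inner_nodes (reduce t) then \<phi> (num_branches r (reduce t)) else 0)"
    proof (intro sum.cong refl)
      fix j
      have "(\<Sum>s\<in>trees j. \<phi> (num_branches r s) * of_bool (t \<noteq> Leaf \<and> reduce t = s)) =
          (\<Sum>s\<in>trees j. if reduce t = s then \<phi> (num_branches r s) else 0)"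
        using False by (intro sum.cong) auto
      also have "\<dots> = (if reduce t \<in> trees j then \<phi> (num_branches r (reduce t)) else 0)"
        by (rule sum.delta'[OF finite_trees])
      finally show "(\<Sum>s\<in>trees j. \<phi> (num_branches r s) * of_bool (t \<noteq> Leaf \<and> reduce t = s)) =
          (if j = inner_nodes (reduce t) then \<phi> (num_branches r (reduce t)) else 0)"
        by (simp add: trees_def eq_commute[of j])
    qed
    also have "\<dots> = \<phi> (num_branches r (reduce t))"
      using inner_nodes_reduce[of t] that by (simp add: trees_def)
    finally show ?thesis
      using False by (simp add: num_branches_Suc)
  qed (simp add: num_branches_Suc assms)
  then have "tree_gf (\<lambda>t. \<phi> (num_branches (Suc r) t)) $ n =
      (\<Sum>t\<in>trees n. \<Sum>j=0..n. \<Sum>s\<in>trees j. \<phi> (num_branches r s) * of_bool (t \<noteq> Leaf \<and> reduce t = s))"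
    by (simp add: tree_gf_nth)
  also have "\<dots> = (\<Sum>j=0..n. \<Sum>t\<in>trees n. \<Sum>s\<in>trees j.
      \<phi> (num_branches r s) * of_bool (t \<noteq> Leaf \<and> reduce t = s))"
    by (rule sum.swap)
  also have "\<dots> = (\<Sum>j=0..n. \<Sum>s\<in>trees j. \<Sum>t\<in>trees n.
      \<phi> (num_branches r s) * of_bool (t \<noteq> Leaf \<and> reduce t = s))"
    by (rule sum.cong[OF refl], rule sum.swap)
  also have "\<dots> = (\<Sum>j=0..n. \<Sum>s\<in>trees j. \<phi> (num_branches r s) *
      tree_gf (\<lambda>t. of_bool (t \<noteq> Leaf \<and> reduce t = s)) $ n)"
    by (simp only: tree_gf_nth sum_distrib_left)
  also have "\<dots> = (\<Sum>j=0..n. \<Sum>s\<in>trees j. \<phi> (num_branches r s) * (fps_X * geom2) ^ (2 * j + 1) $ n)"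
    unfolding tree_gf_reduce by (intro sum.cong refl) (simp add: trees_def)
  also have "\<dots> = lift_gf (tree_gf (\<lambda>t. \<phi> (num_branches r t))) $ n"
    by (simp add: lift_gf_nth tree_gf_nth sum_distrib_right)
  finally show "tree_gf (\<lambda>t. \<phi> (num_branches (Suc r) t)) $ n =
      lift_gf (tree_gf (\<lambda>t. \<phi> (num_branches r t))) $ n" .
qed

subsection \<open>Powers of the discriminant\<close>

definition discr :: "real fps" where
  "discr = 1 - 4 * fps_X"

text \<open>The square root of \<open>discr\<close> with constant term 1 is
  \<open>1 - 2 * fps_X * catalan_gf\<close>, so no fractional powers are needed. The coefficients
  are the central binomial coefficients.\<close>

definition inv_sqrt_discr :: "real fps" where
  "inv_sqrt_discr = inverse (1 - 2 * fps_X * catalan_gf)"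

lemma inv_sqrt_discr_nth_0: "inv_sqrt_discr $ 0 = 1"
  by (simp add: inv_sqrt_discr_def)

lemma inv_sqrt_discr_mult: "inv_sqrt_discr * (1 - 2 * fps_X * catalan_gf) = 1"
  unfolding inv_sqrt_discr_def by (rule inverse_mult_eq_1) simp

text \<open>Completing the square in the quadratic equation of the Catalan series.\<close>

lemma inv_sqrt_discr_square: "inv_sqrt_discr\<^sup>2 * discr = 1"
proof -
  have "(1 - 2 * fps_X * catalan_gf)\<^sup>2 = 1 - 4 * fps_X * (catalan_gf - fps_X * catalan_gf\<^sup>2)"
    by (simp add: power2_eq_square algebra_simps)
  also have "catalan_gf - fps_X * catalan_gf\<^sup>2 = 1"
    using catalan_gf_eq by (simp add: algebra_simps)
  finally have "discr = (1 - 2 * fps_X * catalan_gf)\<^sup>2"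
    by (simp add: discr_def)
  then have "inv_sqrt_discr\<^sup>2 * discr = (inv_sqrt_discr * (1 - 2 * fps_X * catalan_gf))\<^sup>2"
    by (simp only: power_mult_distrib)
  then show ?thesis
    by (simp add: inv_sqrt_discr_mult)
qed

lemma inv_sqrt_discr_times_discr: "inv_sqrt_discr * discr = 1 - 2 * fps_X * catalan_gf"
proof -
  have "inv_sqrt_discr * discr = inv_sqrt_discr * discr * (inv_sqrt_discr * (1 - 2 * fps_X * catalan_gf))"
    by (simp add: inv_sqrt_discr_mult)
  also have "\<dots> = (inv_sqrt_discr\<^sup>2 * discr) * (1 - 2 * fps_X * catalan_gf)"
    by (simp only: power2_eq_square mult_ac)
  finally show ?thesis
    by (simp add: inv_sqrt_discr_square)
qed

lemma fps_deriv_discr [simp]: "fps_deriv discr = -4"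
  by (simp add: discr_def)

text \<open>Differentiate \<open>inv_sqrt_discr\<^sup>2 * discr = 1\<close> and cancel
  \<open>2 * inv_sqrt_discr\<close>.\<close>

lemma discr_times_deriv_inv_sqrt: "discr * fps_deriv inv_sqrt_discr = 2 * inv_sqrt_discr"
proof -
  let ?D = inv_sqrt_discr
  have "fps_deriv (?D\<^sup>2 * discr) = 0"
    by (simp add: inv_sqrt_discr_square)
  then have "2 * ?D * (discr * fps_deriv ?D) = 2 * ?D * (2 * ?D)"
    by (simp add: power2_eq_square algebra_simps)
  moreover have "2 * ?D \<noteq> 0"
    using inv_sqrt_discr_nth_0 by auto
  ultimately show ?thesis
    using mult_left_cancel by blast
qed

lemma inv_sqrt_discr_cube: "2 * inv_sqrt_discr ^ 3 = fps_deriv inv_sqrt_discr"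
proof -
  let ?D = inv_sqrt_discr
  have "2 * ?D ^ 3 = ?D\<^sup>2 * (2 * ?D)"
    by (simp add: power3_eq_cube power2_eq_square)
  also have "\<dots> = (?D\<^sup>2 * discr) * fps_deriv ?D"
    unfolding discr_times_deriv_inv_sqrt[symmetric] by (simp only: mult_ac)
  finally show ?thesis
    by (simp add: inv_sqrt_discr_square)
qed

section \<open>Coefficient recursions and elementary bounds\<close>

lemma discr_mult_nth_Suc: "(f * discr) $ Suc n = f $ Suc n - 4 * f $ n"
proof -
  have "f * discr = f - fps_const 4 * (fps_X * f)"
    by (simp add: discr_def algebra_simps numeral_fps_const)
  then show ?thesis
    by simp
qed

lemma inv_sqrt_discr_nth_Suc:
  "real (Suc n) * inv_sqrt_discr $ Suc n = (4 * real n + 2) * inv_sqrt_discr $ n"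
proof -
  have "(fps_deriv inv_sqrt_discr * discr) $ n = (fps_const 2 * inv_sqrt_discr) $ n"
    using discr_times_deriv_inv_sqrt by (simp add: mult.commute numeral_fps_const)
  then have eq: "(fps_deriv inv_sqrt_discr * discr) $ n = 2 * inv_sqrt_discr $ n"
    by simp
  show ?thesis
  proof (cases n)
    case 0
    then show ?thesis
      using eq by (simp add: discr_def)
  next
    case (Suc m)
    then show ?thesis
      using eq unfolding Suc discr_mult_nth_Suc by (simp add: algebra_simps)
  qed
qed

lemma inv_sqrt_discr_cube_nth: "(inv_sqrt_discr ^ 3) $ n = (2 * real n + 1) * inv_sqrt_discr $ n"
proof -
  have "(fps_const 2 * inv_sqrt_discr ^ 3) $ n = fps_deriv inv_sqrt_discr $ n"
    using inv_sqrt_discr_cube by (simp add: numeral_fps_const)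
  then show ?thesis
    using inv_sqrt_discr_nth_Suc[of n] by (simp add: algebra_simps)
qed

lemma inv_sqrt_discr_nth_pos: "inv_sqrt_discr $ n > 0"
proof (induction n)
  case (Suc n)
  then have "real (Suc n) * inv_sqrt_discr $ Suc n > 0"
    unfolding inv_sqrt_discr_nth_Suc by simp
  then show ?case
    by (simp only: zero_less_mult_iff) auto
qed (simp add: inv_sqrt_discr_nth_0)

lemma inv_sqrt_discr_nth_le: "inv_sqrt_discr $ n \<le> 4 ^ n"
proof (induction n)
  case (Suc n)
  have "real (Suc n) * inv_sqrt_discr $ Suc n \<le> real (Suc n) * (4 * inv_sqrt_discr $ n)"
    unfolding inv_sqrt_discr_nth_Suc using inv_sqrt_discr_nth_pos[of n] by (simp add: algebra_simps)
  then have "inv_sqrt_discr $ Suc n \<le> 4 * inv_sqrt_discr $ n"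
    by (rule mult_left_le_imp_le) simp
  then show ?case
    using Suc by simp
qed (simp add: inv_sqrt_discr_nth_0)

text \<open>By the recursion, \<open>(2 n + 1)\<close> times the coefficient grows by a factor of at
  least 4 in each step. The true size of the coefficient is \<open>4^n / sqrt (pi n)\<close>, so
  only a factor of order \<open>sqrt n\<close> is lost.\<close>

lemma inv_sqrt_discr_nth_ge: "4 ^ n \<le> (2 * real n + 1) * inv_sqrt_discr $ n"
proof (induction n)
  case (Suc n)
  have "real (Suc n) * 4 ^ Suc n \<le> real (Suc n) * 4 * ((2 * real n + 1) * inv_sqrt_discr $ n)"
    using mult_left_mono[OF Suc, of "real (Suc n) * 4"] by (simp add: mult_ac del: of_nat_Suc)
  also have "\<dots> = 2 * real (Suc n) * (real (Suc n) * inv_sqrt_discr $ Suc n)"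
    unfolding inv_sqrt_discr_nth_Suc by (simp add: algebra_simps)
  also have "\<dots> \<le> (2 * real (Suc n) + 1) * (real (Suc n) * inv_sqrt_discr $ Suc n)"
    using inv_sqrt_discr_nth_pos[of "Suc n"] by (intro mult_right_mono) auto
  finally have "real (Suc n) * 4 ^ Suc n \<le> real (Suc n) * ((2 * real (Suc n) + 1) * inv_sqrt_discr $ Suc n)"
    by (simp only: mult_ac)
  then show ?case
    by (rule mult_left_le_imp_le) simp
qed (simp add: inv_sqrt_discr_nth_0)

lemma fps_deriv_inv_sqrt_discr_power:
  "fps_deriv (inv_sqrt_discr * discr ^ Suc i) = - of_nat (4 * i + 2) * (inv_sqrt_discr * discr ^ i)"
proof -
  have "fps_deriv (inv_sqrt_discr * discr ^ Suc i) =
      (discr * fps_deriv inv_sqrt_discr) * discr ^ i + inv_sqrt_discr * fps_deriv (discr ^ Suc i)"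
    by (simp add: algebra_simps)
  also have "fps_deriv (discr ^ Suc i) = of_nat (Suc i) * (-4) * discr ^ i"
    by (simp add: fps_deriv_power' del: power_Suc)
  finally show ?thesis
    unfolding discr_times_deriv_inv_sqrt by (simp add: algebra_simps)
qed

text \<open>The derivative formula and multiplication by \<open>discr\<close> both express the new
  coefficient through old ones; eliminating the old coefficient at \<open>n - 1\<close> leaves this
  ratio. Each further factor \<open>discr\<close> thus gains one power of \<open>n\<close>.\<close>

lemma inv_sqrt_discr_power_nth:
  "(inv_sqrt_discr * discr ^ Suc i) $ n * (2 * real i + 1 - 2 * real n) =
     (2 * real i + 1) * (inv_sqrt_discr * discr ^ i) $ n"
proof (cases n)
  case 0
  then show ?thesis
    by (simp add: discr_def)
next
  case (Suc m)
  define f where "f = inv_sqrt_discr * discr ^ i"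
  have f: "inv_sqrt_discr * discr ^ Suc i = f * discr"
    by (simp add: f_def mult_ac)
  have "fps_deriv (f * discr) $ m = (fps_const (- (4 * real i + 2)) * f) $ m"
    using fps_deriv_inv_sqrt_discr_power[of i] unfolding f f_def[symmetric]
    by (simp only: fps_of_nat[symmetric] fps_const_neg) simp
  then have "real (m + 1) * (f * discr) $ (m + 1) = - (4 * real i + 2) * f $ m"
    unfolding fps_deriv_nth by simp
  then have "real (Suc m) * (f * discr) $ Suc m = - (4 * real i + 2) * f $ m"
    by simp
  moreover have "(f * discr) $ Suc m = f $ Suc m - 4 * f $ m"
    by (rule discr_mult_nth_Suc)
  ultimately show ?thesis
    unfolding f f_def[symmetric] Suc by algebra
qed

text \<open>Compare coefficients after differentiating
  \<open>inv_sqrt_discr * discr = 1 - 2 * fps_X * catalan_gf\<close>; the left side becomes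
  \<open>-2 * inv_sqrt_discr\<close>.\<close>

lemma card_trees_eq: "real (n + 1) * real (card (trees n)) = inv_sqrt_discr $ n"
proof -
  have "fps_deriv (inv_sqrt_discr * discr) = - fps_const 2 * inv_sqrt_discr"
    using fps_deriv_inv_sqrt_discr_power[of 0] by (simp add: numeral_fps_const)
  then have "fps_deriv (inv_sqrt_discr * discr) $ n = - 2 * inv_sqrt_discr $ n"
    by simp
  moreover have "inv_sqrt_discr * discr = 1 - fps_const 2 * (fps_X * catalan_gf)"
    by (simp add: inv_sqrt_discr_times_discr numeral_fps_const mult.assoc)
  ultimately have "real (n + 1) * (1 - fps_const 2 * (fps_X * catalan_gf)) $ (n + 1) = - 2 * inv_sqrt_discr $ n"
    by (simp only: fps_deriv_nth)
  moreover have "(1 - fps_const 2 * (fps_X * catalan_gf)) $ (n + 1) = - 2 * real (card (trees n))"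
    by (simp add: catalan_gf_nth)
  ultimately show ?thesis
    by simp
qed

subsection \<open>The substitution on powers of the discriminant\<close>

text \<open>The numerator is \<open>(1 - 2 X)^2 - 4 X^2 = 1 - 4 X\<close>. Hence the substitution
  fixes the dominant singularity \<open>1/4\<close>.\<close>

lemma geom2_square_discr: "1 - 4 * (fps_X * geom2)\<^sup>2 = discr * geom2\<^sup>2"
proof -
  have "1 - 4 * (fps_X * geom2)\<^sup>2 = (geom2 * (1 - 2 * fps_X))\<^sup>2 - 4 * (fps_X * geom2)\<^sup>2"
    by (simp add: geom2_mult)
  also have "\<dots> = discr * geom2\<^sup>2"
    by (simp add: discr_def power2_eq_square algebra_simps)
  finally show ?thesis .
qed

lemma discr_compose: "discr oo (fps_X * geom2)\<^sup>2 = discr * geom2\<^sup>2"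
proof -
  have "discr oo (fps_X * geom2)\<^sup>2 = 1 - 4 * (fps_X * geom2)\<^sup>2"
    by (simp add: discr_def fps_compose_sub_distrib fps_compose_mult_distrib numeral_fps_const)
  then show ?thesis
    by (simp add: geom2_square_discr)
qed

text \<open>Both sides have the same square, by the defining equation of the inverse root and its
  image under the substitution; the constant terms decide the sign.\<close>

lemma inv_sqrt_discr_compose:
  "inv_sqrt_discr oo (fps_X * geom2)\<^sup>2 = inv_sqrt_discr * (1 - 2 * fps_X)"
proof -
  let ?y2 = "(fps_X * geom2)\<^sup>2" and ?D = inv_sqrt_discr
  have y0: "?y2 $ 0 = 0"
    by (simp add: power2_eq_square)
  have "(?D oo ?y2)\<^sup>2 * (discr oo ?y2) = (?D\<^sup>2 * discr) oo ?y2"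
    by (simp add: fps_compose_mult_distrib[OF y0] fps_compose_power[OF y0])
  also have "\<dots> = 1"
    by (simp add: inv_sqrt_discr_square)
  also have "1 = (?D\<^sup>2 * discr) * (geom2 * (1 - 2 * fps_X))\<^sup>2"
    by (simp add: inv_sqrt_discr_square geom2_mult)
  also have "\<dots> = (?D * (1 - 2 * fps_X))\<^sup>2 * (discr * geom2\<^sup>2)"
    by (simp only: power_mult_distrib mult_ac)
  finally have "(?D oo ?y2)\<^sup>2 * (discr * geom2\<^sup>2) = (?D * (1 - 2 * fps_X))\<^sup>2 * (discr * geom2\<^sup>2)"
    unfolding discr_compose .
  moreover have "discr * geom2\<^sup>2 \<noteq> 0"
  proof -
    have "(discr * geom2\<^sup>2) $ 0 \<noteq> 0"
      by (simp add: discr_def geom2_def power2_eq_square)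
    then show ?thesis
      by force
  qed
  ultimately have "(?D oo ?y2)\<^sup>2 = (?D * (1 - 2 * fps_X))\<^sup>2"
    using mult_right_cancel by blast
  then have "?D oo ?y2 = ?D * (1 - 2 * fps_X) \<or> ?D oo ?y2 = - (?D * (1 - 2 * fps_X))"
    by (simp only: power2_eq_iff)
  moreover have "(?D oo ?y2) $ 0 \<noteq> (- (?D * (1 - 2 * fps_X))) $ 0"
    by (simp add: inv_sqrt_discr_nth_0)
  ultimately show ?thesis
    by metis
qed

lemma lift_gf_mult: "lift_gf (f * g) = lift_gf f * (g oo (fps_X * geom2)\<^sup>2)"
  unfolding lift_gf_def by (subst fps_compose_mult_distrib) (auto simp: power2_eq_square mult_ac)

lemma lift_gf_add: "lift_gf (f + g) = lift_gf f + lift_gf g"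
  by (simp add: lift_gf_def fps_compose_add_distrib algebra_simps)

lemma lift_gf_diff: "lift_gf (f - g) = lift_gf f - lift_gf g"
  by (simp add: lift_gf_def fps_compose_sub_distrib algebra_simps)

lemma lift_gf_const_mult: "lift_gf (fps_const c * f) = fps_const c * lift_gf f"
  by (subst mult.commute, subst lift_gf_mult) (simp add: mult.commute)

lemma lift_gf_inv_sqrt: "lift_gf inv_sqrt_discr = fps_X * inv_sqrt_discr"
proof -
  have "lift_gf inv_sqrt_discr = fps_X * inv_sqrt_discr * (geom2 * (1 - 2 * fps_X))"
    unfolding lift_gf_def inv_sqrt_discr_compose by (simp only: mult_ac)
  then show ?thesis
    by (simp add: geom2_mult)
qed

lemma subst_nth_0: "((fps_X * geom2)\<^sup>2) $ 0 = 0"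
  by (simp add: power2_eq_square)

lemma lift_gf_inv_sqrt_power:
  "lift_gf (inv_sqrt_discr * discr ^ i) = fps_X * inv_sqrt_discr * discr ^ i * geom2 ^ (2 * i)"
proof -
  have "(discr ^ i) oo (fps_X * geom2)\<^sup>2 = discr ^ i * geom2 ^ (2 * i)"
    unfolding fps_compose_power[OF subst_nth_0, symmetric] discr_compose
    by (simp only: power_mult_distrib power_mult)
  then show ?thesis
    by (simp only: lift_gf_mult lift_gf_inv_sqrt mult.assoc)
qed

text \<open>Exact, without remainder: \<open>16 X (1 - 2 X)^2 = (1 - x) (1 + x)^2\<close> is a
  polynomial in \<open>x = discr\<close>, and each product
  \<open>inv_sqrt_discr\<^sup>2 * discr\<close> collapses to 1.\<close>

lemma lift_gf_inv_sqrt_cube: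
  "lift_gf (inv_sqrt_discr ^ 3) = fps_const (1/16) *
     (inv_sqrt_discr ^ 3 + inv_sqrt_discr - inv_sqrt_discr * discr - inv_sqrt_discr * discr\<^sup>2)"
proof -
  let ?D = inv_sqrt_discr
  have "(?D\<^sup>2) oo (fps_X * geom2)\<^sup>2 = (?D * (1 - 2 * fps_X))\<^sup>2"
    by (simp only: fps_compose_power[OF subst_nth_0, symmetric] inv_sqrt_discr_compose)
  then have "lift_gf (?D * ?D\<^sup>2) = fps_X * ?D * (?D * (1 - 2 * fps_X))\<^sup>2"
    by (simp only: lift_gf_mult lift_gf_inv_sqrt)
  moreover have "?D * ?D\<^sup>2 = ?D ^ 3"
    by algebra
  ultimately have "fps_const 16 * lift_gf (?D ^ 3) = 16 * (fps_X * ?D * (?D * (1 - 2 * fps_X))\<^sup>2)"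
    by (simp add: numeral_fps_const)
  also have "\<dots> = ?D ^ 3 * ((4 * fps_X) * (2 * (1 - 2 * fps_X))\<^sup>2)"
    by algebra
  also have "(4 * fps_X) * (2 * (1 - 2 * fps_X))\<^sup>2 = (1 - discr) * (1 + discr)\<^sup>2"
    by (simp add: discr_def)
  also have "?D ^ 3 * \<dots> = ?D ^ 3 + ?D * (?D\<^sup>2 * discr) - ?D * (?D\<^sup>2 * discr) * discr - ?D * (?D\<^sup>2 * discr) * discr\<^sup>2"
    by (simp add: power3_eq_cube power2_eq_square algebra_simps)
  finally have "fps_const (1/16) * (fps_const 16 * lift_gf (?D ^ 3)) =
      fps_const (1/16) * (?D ^ 3 + ?D - ?D * discr - ?D * discr\<^sup>2)"
    by (simp add: inv_sqrt_discr_square)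
  moreover have "fps_const (1/16) * (fps_const 16 * lift_gf (?D ^ 3)) = lift_gf (?D ^ 3)"
    by (simp add: mult.assoc[symmetric])
  ultimately show ?thesis
    by simp
qed

subsection \<open>Negligible power series\<close>

text \<open>The Catalan numbers grow like \<open>4\<^sup>n n\<^sup>-\<^sup>3\<^sup>/\<^sup>2\<close>; the exponent 5 leaves enough room for the
  crude bound \<open>inv_sqrt_discr_nth_ge\<close> in place of Stirling's formula.\<close>

definition negligible :: "real fps \<Rightarrow> bool" where
  "negligible f \<longleftrightarrow> (\<exists>K. \<forall>n. \<bar>f $ n\<bar> * real (n + 1) ^ 5 \<le> K * 4 ^ n)"

lemma negligible_add:
  assumes "negligible f" "negligible g"
  shows "negligible (f + g)"
proof -
  obtain K L where "\<And>n. \<bar>f $ n\<bar> * real (n + 1) ^ 5 \<le> K * 4 ^ n"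
    and "\<And>n. \<bar>g $ n\<bar> * real (n + 1) ^ 5 \<le> L * 4 ^ n"
    using assms unfolding negligible_def by blast
  then have "\<bar>f $ n\<bar> * real (n + 1) ^ 5 + \<bar>g $ n\<bar> * real (n + 1) ^ 5 \<le> (K + L) * 4 ^ n" for n
    by (simp add: distrib_right add_mono)
  moreover have "\<bar>(f + g) $ n\<bar> * real (n + 1) ^ 5 \<le>
      \<bar>f $ n\<bar> * real (n + 1) ^ 5 + \<bar>g $ n\<bar> * real (n + 1) ^ 5" for n
    by (simp flip: distrib_right add: mult_right_mono)
  ultimately show ?thesis
    unfolding negligible_def by (meson order_trans)
qed

lemma summable_poly_over_exp: "summable (\<lambda>k. real (k + 1) ^ 5 * (1/2) ^ k)"
proof (rule summable_comparison_test_bigo)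
  show "summable (\<lambda>k. norm ((3/4 :: real) ^ k))"
    by (simp add: summable_geometric)
  show "(\<lambda>k. real (k + 1) ^ 5 * (1/2) ^ k) \<in> O(\<lambda>k. (3/4) ^ k)"
    by real_asymp
qed

text \<open>Against the growth rate 4 of \<open>f\<close>, the coefficients of \<open>g\<close>
  contribute a factor \<open>(1/2)^i\<close>, which makes the convolution sum converge even with the
  polynomial weight.\<close>

lemma negligible_mult:
  assumes f: "negligible f" and g: "\<And>k. \<bar>g $ k\<bar> \<le> C * 2 ^ k"
  shows "negligible (f * g)"
proof -
  obtain K where K: "\<And>n. \<bar>f $ n\<bar> * real (n + 1) ^ 5 \<le> K * 4 ^ n"
    using f unfolding negligible_def by blast
  define S where "S = (\<Sum>k. real (k + 1) ^ 5 * (1/2 :: real) ^ k)"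
  have K0: "K \<ge> 0"
    using K[of 0] order_trans[OF abs_ge_zero, of "f $ 0" K] by simp
  have C0: "C \<ge> 0"
    using g[of 0] by simp
  have "\<bar>(f * g) $ n\<bar> * real (n + 1) ^ 5 \<le> K * C * S * 4 ^ n" for n
  proof -
    have "\<bar>(f * g) $ n\<bar> * real (n + 1) ^ 5 \<le> (\<Sum>i=0..n. \<bar>g $ i * f $ (n - i)\<bar>) * real (n + 1) ^ 5"
      unfolding mult.commute[of f g] fps_mult_nth by (intro mult_right_mono sum_abs) simp
    also have "\<dots> = (\<Sum>i=0..n. \<bar>g $ i\<bar> * \<bar>f $ (n - i)\<bar> * real (n + 1) ^ 5)"
      by (simp add: sum_distrib_right abs_mult)
    also have "\<dots> \<le> (\<Sum>i=0..n. K * C * 4 ^ n * (real (i + 1) ^ 5 * (1/2) ^ i))"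
    proof (rule sum_mono)
      fix i assume "i \<in> {0..n}"
      then have i: "i \<le> n" by simp
      \<comment> \<open>This distributes the weight \<open>(n + 1)^5\<close> over the two factors of
        the convolution.\<close>
      have "n + 1 \<le> (i + 1) * (n - i + 1)"
        using i by (auto dest!: le_Suc_ex)
      then have "real (n + 1) \<le> real (i + 1) * real (n - i + 1)"
        unfolding of_nat_mult[symmetric] of_nat_le_iff .
      then have "real (n + 1) ^ 5 \<le> (real (i + 1) * real (n - i + 1)) ^ 5"
        by (intro power_mono) auto
      then have "\<bar>g $ i\<bar> * \<bar>f $ (n - i)\<bar> * real (n + 1) ^ 5 \<le>
          \<bar>g $ i\<bar> * \<bar>f $ (n - i)\<bar> * (real (i + 1) ^ 5 * real (n - i + 1) ^ 5)"
        unfolding power_mult_distrib by (intro mult_left_mono) auto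
      also have "\<dots> = (\<bar>g $ i\<bar> * real (i + 1) ^ 5) * (\<bar>f $ (n - i)\<bar> * real (n - i + 1) ^ 5)"
        by (simp only: mult_ac)
      also have "\<dots> \<le> (C * 2 ^ i * real (i + 1) ^ 5) * (K * 4 ^ (n - i))"
        by (rule mult_mono[OF mult_right_mono[OF g] K]) (use C0 in auto)
      also have "\<dots> = K * C * 4 ^ n * (real (i + 1) ^ 5 * (1/2) ^ i)"
      proof -
        have "(4::real) ^ n = 4 ^ (n - i) * (2 ^ i * 2 ^ i)"
          using i by (simp flip: power_mult_distrib power_add)
        then show ?thesis
          by (simp add: power_divide)
      qed
      finally show "\<bar>g $ i\<bar> * \<bar>f $ (n - i)\<bar> * real (n + 1) ^ 5 \<le>
          K * C * 4 ^ n * (real (i + 1) ^ 5 * (1/2) ^ i)" .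
    qed
    also have "\<dots> = K * C * 4 ^ n * (\<Sum>i=0..n. real (i + 1) ^ 5 * (1/2) ^ i)"
      by (simp only: sum_distrib_left)
    also have "\<dots> \<le> K * C * 4 ^ n * S"
      unfolding S_def using K0 C0 by (intro mult_left_mono sum_le_suminf summable_poly_over_exp) auto
    finally show ?thesis
      by (simp only: mult_ac)
  qed
  then show ?thesis
    unfolding negligible_def by blast
qed

text \<open>Unlike the bound \<open>C * 2^k\<close> on coefficients, which already fails for
  \<open>geom2\<^sup>2\<close>, this property is closed under products.\<close>

definition multiplier :: "real fps \<Rightarrow> bool" where
  "multiplier g \<longleftrightarrow> (\<forall>f. negligible f \<longrightarrow> negligible (f * g))"

lemma multiplierI: "(\<And>k. \<bar>g $ k\<bar> \<le> C * 2 ^ k) \<Longrightarrow> multiplier g"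
  unfolding multiplier_def using negligible_mult by blast

lemma multiplier_const: "multiplier (fps_const c)"
  by (rule multiplierI[of _ "\<bar>c\<bar>"]) (auto simp: mult_le_cancel_left1)

lemma multiplier_numeral: "multiplier (numeral k)"
  by (simp add: numeral_fps_const multiplier_const)

lemma multiplier_X: "multiplier fps_X"
  by (rule multiplierI[of _ 1]) (auto simp: fps_X_def)

lemma geom2_nth: "geom2 $ n = 2 ^ n"
proof (induction n)
  case (Suc n)
  have "geom2 * (1 - 2 * fps_X) = geom2 - fps_const 2 * (fps_X * geom2)"
    by (simp add: algebra_simps numeral_fps_const)
  then have "(geom2 - fps_const 2 * (fps_X * geom2)) $ Suc n = 1 $ Suc n"
    by (simp add: geom2_mult)
  then show ?case
    using Suc by simp
qed (simp add: geom2_def)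

lemma multiplier_geom2: "multiplier geom2"
  by (rule multiplierI[of _ 1]) (simp add: geom2_nth)

lemma multiplier_add: "multiplier f \<Longrightarrow> multiplier g \<Longrightarrow> multiplier (f + g)"
  by (simp add: multiplier_def distrib_left negligible_add)

lemma multiplier_mult: "multiplier f \<Longrightarrow> multiplier g \<Longrightarrow> multiplier (f * g)"
  by (simp add: multiplier_def mult.assoc[symmetric])

lemma multiplier_diff: "multiplier f \<Longrightarrow> multiplier g \<Longrightarrow> multiplier (f - g)"
  using multiplier_add[of f "fps_const (- 1) * g"] multiplier_mult[OF multiplier_const, of g "- 1"]
  by (simp add: fps_const_neg[symmetric] del: fps_const_neg)

lemma multiplier_power: "multiplier f \<Longrightarrow> multiplier (f ^ k)"
  using multiplier_const[of 1] by (induction k) (simp_all add: multiplier_mult)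

lemmas multiplier_intros = multiplier_add multiplier_diff multiplier_mult multiplier_power
  multiplier_geom2 multiplier_X multiplier_numeral

lemma negligible_const_mult: "negligible f \<Longrightarrow> negligible (fps_const c * f)"
  using multiplier_const[of c] by (simp add: multiplier_def mult.commute)

text \<open>Start from the bound \<open>4^n\<close> for \<open>inv_sqrt_discr\<close>; each of the
  five factors \<open>discr\<close> improves it by a factor of order \<open>n\<close>.\<close>

lemma negligible_inv_sqrt_power_5: "negligible (inv_sqrt_discr * discr ^ 5)"
proof -
  have step: "\<bar>(inv_sqrt_discr * discr ^ Suc i) $ n\<bar> * real (n + 1) \<le>
      90 * \<bar>(inv_sqrt_discr * discr ^ i) $ n\<bar>" if "i \<le> 4" for i n
  proof -
    \<comment> \<open>Parity keeps the divisor away from 0, which settles \<open>n \<le> 9\<close>;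
      for larger \<open>n\<close> it grows linearly. The constant 90 is 10 times the maximum 9 of
      \<open>2 * i + 1\<close>.\<close>
    have "odd (2 * int i + 1 - 2 * int n)"
      by simp
    then have "\<bar>2 * int i + 1 - 2 * int n\<bar> \<ge> 1"
      by (cases "2 * int i + 1 - 2 * int n = 0") auto
    then have "int (n + 1) \<le> 10 * \<bar>2 * int i + 1 - 2 * int n\<bar>"
      using that by (cases "n \<le> 9") auto
    then have "real_of_int (int (n + 1)) \<le> real_of_int (10 * \<bar>2 * int i + 1 - 2 * int n\<bar>)"
      by (simp only: of_int_le_iff)
    then have n: "real (n + 1) \<le> 10 * \<bar>2 * real i + 1 - 2 * real n\<bar>"
      by simp
    have "\<bar>(inv_sqrt_discr * discr ^ Suc i) $ n\<bar> * real (n + 1) \<le>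
        \<bar>(inv_sqrt_discr * discr ^ Suc i) $ n\<bar> * (10 * \<bar>2 * real i + 1 - 2 * real n\<bar>)"
      using n by (rule mult_left_mono) simp
    also have "\<dots> = 10 * \<bar>(inv_sqrt_discr * discr ^ Suc i) $ n * (2 * real i + 1 - 2 * real n)\<bar>"
      by (simp only: abs_mult mult_ac)
    also have "\<dots> = 10 * (2 * real i + 1) * \<bar>(inv_sqrt_discr * discr ^ i) $ n\<bar>"
      unfolding inv_sqrt_discr_power_nth by (simp add: abs_mult)
    also have "\<dots> \<le> 90 * \<bar>(inv_sqrt_discr * discr ^ i) $ n\<bar>"
      using that by (intro mult_right_mono) auto
    finally show ?thesis .
  qed
  have "\<bar>(inv_sqrt_discr * discr ^ i) $ n\<bar> * real (n + 1) ^ i \<le> 90 ^ i * 4 ^ n" if "i \<le> 5" for i n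
    using that
  proof (induction i)
    case 0
    then show ?case
      using inv_sqrt_discr_nth_le[of n] inv_sqrt_discr_nth_pos[of n] by simp
  next
    case (Suc i)
    have "\<bar>(inv_sqrt_discr * discr ^ Suc i) $ n\<bar> * real (n + 1) ^ Suc i =
        \<bar>(inv_sqrt_discr * discr ^ Suc i) $ n\<bar> * real (n + 1) * real (n + 1) ^ i"
      by (simp only: power_Suc mult_ac)
    also have "\<dots> \<le> 90 * \<bar>(inv_sqrt_discr * discr ^ i) $ n\<bar> * real (n + 1) ^ i"
      using Suc.prems by (intro mult_right_mono step) auto
    also have "\<dots> \<le> 90 * (90 ^ i * 4 ^ n)"
      using Suc by simp
    finally show ?case
      by simp
  qed
  from this[of 5] show ?thesis
    unfolding negligible_def by blast
qed

text \<open>The power of 2 is \<open>m - k\<close>, written as a quotient to avoid truncated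
  subtraction. The equation \<open>y = 2 X y + X\<close> turns into Pascal's rule.\<close>

lemma subst_power_nth: "((fps_X * geom2) ^ Suc k) $ Suc m = real (m choose k) * 2 ^ m / 2 ^ k"
proof (induction m arbitrary: k)
  let ?y = "fps_X * geom2"
  have rec: "(?y ^ Suc k) $ Suc n = 2 * (?y ^ Suc k) $ n + (?y ^ k) $ n" for k n
  proof -
    have "?y = ?y * (2 * fps_X) + fps_X * (geom2 * (1 - 2 * fps_X))"
      by (simp add: algebra_simps)
    then have y: "?y = ?y * (2 * fps_X) + fps_X"
      by (simp only: geom2_mult mult_1_right)
    have "?y ^ Suc k = (?y * (2 * fps_X) + fps_X) * ?y ^ k"
      using y by simp
    also have "\<dots> = fps_X * (fps_const 2 * ?y ^ Suc k + ?y ^ k)"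
      by (simp add: algebra_simps numeral_fps_const)
    finally have "(?y ^ Suc k) $ Suc n = (fps_X * (fps_const 2 * ?y ^ Suc k + ?y ^ k)) $ Suc n"
      by (rule arg_cong)
    also have "\<dots> = (fps_const 2 * ?y ^ Suc k + ?y ^ k) $ n"
      by (simp only: fps_X_mult_nth) simp
    finally show ?thesis
      by (simp only: fps_add_nth fps_mult_left_const_nth)
  qed
  {
    case 0
    show ?case
      unfolding rec by (cases k) simp_all
  next
    case (Suc m)
    show ?case
    proof (cases k)
      case 0
      then show ?thesis
        using rec[of 0 "Suc m"] Suc.IH[of 0] by simp
    next
      case (Suc j)
      show ?thesis
        unfolding rec[of k] Suc.IH unfolding Suc Suc.IH by (simp add: field_simps)
    qed
  }
qed

section \<open>Stability of negligible series under the substitution\<close>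

lemma binomial_shift_5:
  "(m choose k) * ((m + 1) * (m + 2) * (m + 3) * (m + 4) * (m + 5)) =
     ((m + 5) choose (k + 5)) * ((k + 1) * (k + 2) * (k + 3) * (k + 4) * (k + 5))"
proof -
  have chain: "B0 * (p1 * p2 * p3 * p4 * p5) = B5 * (q1 * q2 * q3 * q4 * q5)"
    if "q1 * B1 = p1 * B0" "q2 * B2 = p2 * B1" "q3 * B3 = p3 * B2" "q4 * B4 = p4 * B3" "q5 * B5 = p5 * B4"
    for B0 B1 B2 B3 B4 B5 p1 p2 p3 p4 p5 q1 q2 q3 q4 q5 :: nat
  proof -
    have "B0 * (p1 * p2 * p3 * p4 * p5) = (p1 * B0) * (p2 * p3 * p4 * p5)"
      by (simp only: mult_ac)
    also have "\<dots> = q1 * (p2 * B1) * (p3 * p4 * p5)"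
      unfolding that(1)[symmetric] by (simp only: mult_ac)
    also have "\<dots> = q1 * q2 * (p3 * B2) * (p4 * p5)"
      unfolding that(2)[symmetric] by (simp only: mult_ac)
    also have "\<dots> = q1 * q2 * q3 * (p4 * B3) * p5"
      unfolding that(3)[symmetric] by (simp only: mult_ac)
    also have "\<dots> = q1 * q2 * q3 * q4 * (p5 * B4)"
      unfolding that(4)[symmetric] by (simp only: mult_ac)
    also have "\<dots> = B5 * (q1 * q2 * q3 * q4 * q5)"
      unfolding that(5)[symmetric] by (simp only: mult_ac)
    finally show ?thesis .
  qed
  have step: "(k + Suc i) * ((m + Suc i) choose (k + Suc i)) = (m + Suc i) * ((m + i) choose (k + i))" for i
    using Suc_times_binomial[of "k + i" "m + i"] by simp
  have "(k + 1) * ((m + 1) choose (k + 1)) = (m + 1) * (m choose k)"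
    "(k + 2) * ((m + 2) choose (k + 2)) = (m + 2) * ((m + 1) choose (k + 1))"
    "(k + 3) * ((m + 3) choose (k + 3)) = (m + 3) * ((m + 2) choose (k + 2))"
    "(k + 4) * ((m + 4) choose (k + 4)) = (m + 4) * ((m + 3) choose (k + 3))"
    "(k + 5) * ((m + 5) choose (k + 5)) = (m + 5) * ((m + 4) choose (k + 4))"
    using step[of 0] step[of 1] step[of 2] step[of 3] step[of 4] by simp_all
  then show ?thesis
    by (rule chain)
qed

text \<open>Trades the weight in \<open>m\<close> for a weight in \<open>j\<close> and a shifted
  binomial coefficient. The constant is \<open>2^5 * 5^5\<close>, from
  \<open>m + 2 \<le> 2 (m + 1)\<close> and \<open>2 j + 5 \<le> 5 (j + 1)\<close>.\<close>

lemma binomial_shift_5_bound: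
  "(m choose (2 * j)) * (m + 2) ^ 5 \<le> 10 ^ 5 * (j + 1) ^ 5 * ((m + 5) choose (2 * j + 5))"
proof -
  have power5: "a ^ 5 = a * a * a * a * a" for a :: nat
    by (simp add: eval_nat_numeral)
  have "(m choose (2 * j)) * (m + 2) ^ 5 \<le>
      2 ^ 5 * ((m choose (2 * j)) * ((m + 1) * (m + 2) * (m + 3) * (m + 4) * (m + 5)))"
  proof -
    have "(m + 2) ^ 5 \<le> (2 * (m + 1)) ^ 5"
      by (rule power_mono) auto
    also have "\<dots> = 2 ^ 5 * ((m + 1) * (m + 1) * (m + 1) * (m + 1) * (m + 1))"
      by (simp only: power_mult_distrib power5[of "m + 1"])
    also have "\<dots> \<le> 2 ^ 5 * ((m + 1) * (m + 2) * (m + 3) * (m + 4) * (m + 5))"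
      by (intro mult_mono) auto
    finally show ?thesis
      by (simp add: mult.left_commute)
  qed
  also have "\<dots> = 2 ^ 5 * (((m + 5) choose (2 * j + 5)) *
      ((2 * j + 1) * (2 * j + 2) * (2 * j + 3) * (2 * j + 4) * (2 * j + 5)))"
    by (simp only: binomial_shift_5)
  also have "\<dots> \<le> 2 ^ 5 * (((m + 5) choose (2 * j + 5)) *
      ((5 * (j + 1)) * (5 * (j + 1)) * (5 * (j + 1)) * (5 * (j + 1)) * (5 * (j + 1))))"
    by (intro mult_mono le_refl) auto
  also have "\<dots> = 10 ^ 5 * (j + 1) ^ 5 * ((m + 5) choose (2 * j + 5))"
  proof -
    have "2 ^ 5 * (B * ((5 * a) * (5 * a) * (5 * a) * (5 * a) * (5 * a))) = 10 ^ 5 * a ^ 5 * B" for a B :: nat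
      by (simp add: power5[of a])
    then show ?thesis .
  qed
  finally show ?thesis .
qed

lemma sum_binomial_odd_le: "(\<Sum>j=0..n. (M choose (2 * j + 5))) \<le> 2 ^ M"
proof -
  have "(\<Sum>j=0..n. (M choose (2 * j + 5))) = (\<Sum>i\<in>(\<lambda>j. 2 * j + 5) ` {0..n}. M choose i)"
    by (subst sum.reindex) (auto simp: inj_on_def)
  also have "\<dots> \<le> (\<Sum>i\<in>{..M} \<union> (\<lambda>j. 2 * j + 5) ` {0..n}. M choose i)"
    by (rule sum_mono2) auto
  also have "\<dots> = (\<Sum>i\<le>M. M choose i)"
    by (rule sum.mono_neutral_right) auto
  also have "\<dots> = 2 ^ M"
    by (rule choose_row_sum)
  finally show ?thesis .
qed

text \<open>The factor \<open>4^j\<close> in the bound for \<open>f\<close> cancels the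
  \<open>4^j\<close> in the denominator of the coefficient of \<open>y^(2j+1)\<close>, the weight
  \<open>(j + 1)^5\<close> is supplied by the binomial shift, and what remains is bounded by a full
  binomial row.\<close>

lemma negligible_lift_gf:
  assumes "negligible f"
  shows "negligible (lift_gf f)"
proof -
  obtain K where K: "\<And>n. \<bar>f $ n\<bar> * real (n + 1) ^ 5 \<le> K * 4 ^ n"
    using assms unfolding negligible_def by blast
  have K0: "K \<ge> 0"
    using K[of 0] order_trans[OF abs_ge_zero, of "f $ 0" K] by simp
  have "\<bar>lift_gf f $ n\<bar> * real (n + 1) ^ 5 \<le> 8 * 10 ^ 5 * K * 4 ^ n" for n
  proof (cases n)
    case 0
    then show ?thesis
      using K0 by (simp add: lift_gf_def)
  next
    case (Suc m)
    have "\<bar>lift_gf f $ n\<bar> * real (n + 1) ^ 5 \<le>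
        (\<Sum>j=0..n. \<bar>f $ j * (fps_X * geom2) ^ (2 * j + 1) $ n\<bar>) * real (n + 1) ^ 5"
      unfolding lift_gf_nth by (intro mult_right_mono sum_abs) simp
    also have "\<dots> = (\<Sum>j=0..n. \<bar>f $ j\<bar> * (real (m choose (2 * j)) * 2 ^ m / 4 ^ j) * real (m + 2) ^ 5)"
      unfolding sum_distrib_right
    proof (rule sum.cong[OF refl])
      fix j
      have "(fps_X * geom2) ^ (2 * j + 1) $ n = real (m choose (2 * j)) * 2 ^ m / 4 ^ j"
        using subst_power_nth[of "2 * j" m] by (simp add: Suc power_mult)
      then show "\<bar>f $ j * (fps_X * geom2) ^ (2 * j + 1) $ n\<bar> * real (n + 1) ^ 5 =
          \<bar>f $ j\<bar> * (real (m choose (2 * j)) * 2 ^ m / 4 ^ j) * real (m + 2) ^ 5"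
        by (simp add: abs_mult Suc)
    qed
    also have "\<dots> \<le> (\<Sum>j=0..n. 10 ^ 5 * K * 2 ^ m * real ((m + 5) choose (2 * j + 5)))"
    proof (rule sum_mono)
      fix j
      have "real ((m choose (2 * j)) * (m + 2) ^ 5) \<le>
          real (10 ^ 5 * (j + 1) ^ 5 * ((m + 5) choose (2 * j + 5)))"
        unfolding of_nat_le_iff by (rule binomial_shift_5_bound)
      then have b: "real (m choose (2 * j)) * real (m + 2) ^ 5 \<le>
          10 ^ 5 * real (j + 1) ^ 5 * real ((m + 5) choose (2 * j + 5))"
        by (simp only: of_nat_mult of_nat_power of_nat_numeral)
      have "\<bar>f $ j\<bar> * (real (m choose (2 * j)) * 2 ^ m / 4 ^ j) * real (m + 2) ^ 5 =
          \<bar>f $ j\<bar> * (2 ^ m / 4 ^ j) * (real (m choose (2 * j)) * real (m + 2) ^ 5)"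
        by simp
      also have "\<dots> \<le> \<bar>f $ j\<bar> * (2 ^ m / 4 ^ j) *
          (10 ^ 5 * real (j + 1) ^ 5 * real ((m + 5) choose (2 * j + 5)))"
        by (intro mult_left_mono b) simp
      also have "\<dots> = (\<bar>f $ j\<bar> * real (j + 1) ^ 5) *
          (2 ^ m / 4 ^ j * 10 ^ 5 * real ((m + 5) choose (2 * j + 5)))"
        by (simp only: mult_ac)
      also have "\<dots> \<le> K * 4 ^ j * (2 ^ m / 4 ^ j * 10 ^ 5 * real ((m + 5) choose (2 * j + 5)))"
        by (intro mult_right_mono K) simp
      finally show "\<bar>f $ j\<bar> * (real (m choose (2 * j)) * 2 ^ m / 4 ^ j) * real (m + 2) ^ 5 \<le>
          10 ^ 5 * K * 2 ^ m * real ((m + 5) choose (2 * j + 5))"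
        by simp
    qed
    also have "\<dots> = 10 ^ 5 * K * 2 ^ m * real (\<Sum>j=0..n. (m + 5) choose (2 * j + 5))"
      by (simp only: sum_distrib_left of_nat_sum)
    also have "\<dots> \<le> 10 ^ 5 * K * 2 ^ m * real (2 ^ (m + 5))"
      using K0 by (intro mult_left_mono, subst of_nat_le_iff, intro sum_binomial_odd_le) auto
    \<comment> \<open>With \<open>n = m + 1\<close>,
      \<open>2^m * 2^(m+5) = 32 * 4^m = 8 * 4^n\<close>.\<close>
    also have "\<dots> = 8 * 10 ^ 5 * K * 4 ^ n"
    proof -
      have "(4::real) ^ m = 2 ^ m * 2 ^ m"
        by (simp flip: power_mult_distrib)
      then show ?thesis
        by (simp add: Suc power_add)
    qed
    finally show ?thesis .
  qed
  then show ?thesis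
    unfolding negligible_def by blast
qed

subsection \<open>Expansions around the dominant singularity\<close>

text \<open>In the instances below, \<open>p\<close> is the expansion of \<open>X x\<^bsup>i\<^esup> (1 - 2 X)\<^bsup>-2i\<^esup>\<close> in powers of \<open>x = 1 - 4 X\<close>,
  truncated at \<open>x\<^sup>5\<close>, and \<open>w\<close> is the polynomial cofactor of the remainder.\<close>

lemma negligible_lift_power:
  assumes p: "fps_X * discr ^ i = p * (1 - 2 * fps_X) ^ k + discr ^ 5 * w"
    and k: "k = 2 * i" and w: "multiplier w"
  shows "negligible (lift_gf (inv_sqrt_discr * discr ^ i) - inv_sqrt_discr * p)"
proof -
  have inv: "geom2 ^ k * (1 - 2 * fps_X) ^ k = 1"
    unfolding power_mult_distrib[symmetric] by (simp add: geom2_mult)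
  have "lift_gf (inv_sqrt_discr * discr ^ i) = inv_sqrt_discr * (geom2 ^ k * (fps_X * discr ^ i))"
    unfolding lift_gf_inv_sqrt_power k by (simp only: mult_ac)
  also have "\<dots> = inv_sqrt_discr * (p * (geom2 ^ k * (1 - 2 * fps_X) ^ k)) +
      (inv_sqrt_discr * discr ^ 5) * (geom2 ^ k * w)"
    unfolding p by (simp only: distrib_left mult_ac)
  finally have "lift_gf (inv_sqrt_discr * discr ^ i) - inv_sqrt_discr * p =
      (inv_sqrt_discr * discr ^ 5) * (geom2 ^ k * w)"
    unfolding inv by simp
  then show ?thesis
    using negligible_inv_sqrt_power_5 multiplier_mult[OF multiplier_power[OF multiplier_geom2] w]
    by (simp add: multiplier_def)
qed

lemma negligible_lift_power_1:
  "negligible (lift_gf (inv_sqrt_discr * discr) -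
     inv_sqrt_discr * (discr - 3 * discr\<^sup>2 + 5 * discr ^ 3 - 7 * discr ^ 4))"
proof -
  \<comment> \<open>In terms of \<open>x\<close>, the function to expand is
    \<open>4^(i-1) x^i (1 - x) (1 + x)^(-2i)\<close>; for \<open>i = 1\<close> its coefficients are
    1, -3, 5, -7. The identity clears the denominator.\<close>
  have "z * (1 - 4 * z) ^ 1 = ((1 - 4 * z) - 3 * (1 - 4 * z)\<^sup>2 + 5 * (1 - 4 * z) ^ 3 - 7 * (1 - 4 * z) ^ 4) *
      (1 - 2 * z) ^ 2 + (1 - 4 * z) ^ 5 * (4 - 7 * z)" for z :: "real fps"
    by algebra
  from negligible_lift_power[OF this[of fps_X, folded discr_def]] show ?thesis
    by (simp add: multiplier_intros)
qed

lemma negligible_lift_power_2: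
  "negligible (lift_gf (inv_sqrt_discr * discr\<^sup>2) -
     inv_sqrt_discr * (4 * discr\<^sup>2 - 20 * discr ^ 3 + 56 * discr ^ 4))"
proof -
  have "z * (1 - 4 * z)\<^sup>2 = (4 * (1 - 4 * z)\<^sup>2 - 20 * (1 - 4 * z) ^ 3 + 56 * (1 - 4 * z) ^ 4) *
      (1 - 2 * z) ^ 4 + (1 - 4 * z) ^ 5 * (209 * z - 40 - 372 * z\<^sup>2 + 224 * z ^ 3)" for z :: "real fps"
    by algebra
  from negligible_lift_power[OF this[of fps_X, folded discr_def]] show ?thesis
    by (simp add: multiplier_intros)
qed

lemma negligible_lift_power_3:
  "negligible (lift_gf (inv_sqrt_discr * discr ^ 3) -
     inv_sqrt_discr * (16 * discr ^ 3 - 112 * discr ^ 4))"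
proof -
  have "z * (1 - 4 * z) ^ 3 = (16 * (1 - 4 * z) ^ 3 - 112 * (1 - 4 * z) ^ 4) * (1 - 2 * z) ^ 6 +
      (1 - 4 * z) ^ 5 * (96 - 831 * z + 2952 * z\<^sup>2 - 5328 * z ^ 3 + 4864 * z ^ 4 - 1792 * z ^ 5)"
    for z :: "real fps"
    by algebra
  from negligible_lift_power[OF this[of fps_X, folded discr_def]] show ?thesis
    by (simp add: multiplier_intros)
qed

lemma negligible_lift_power_4:
  "negligible (lift_gf (inv_sqrt_discr * discr ^ 4) - inv_sqrt_discr * (64 * discr ^ 4))"
proof -
  have "z * (1 - 4 * z) ^ 4 = 64 * (1 - 4 * z) ^ 4 * (1 - 2 * z) ^ 8 +
      (1 - 4 * z) ^ 5 * (769 * z - 64 - 4092 * z\<^sup>2 + 12304 * z ^ 3 - 22464 * z ^ 4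
        + 24832 * z ^ 5 - 15360 * z ^ 6 + 4096 * z ^ 7)" for z :: "real fps"
    by algebra
  from negligible_lift_power[OF this[of fps_X, folded discr_def]] show ?thesis
    by (simp add: multiplier_intros)
qed

text \<open>An expansion in the powers \<open>x^(-3/2), x^(-1/2), ..., x^(7/2)\<close> of
  \<open>x = discr\<close>; the next power \<open>x^(9/2)\<close> is negligible.\<close>

definition singular_part :: "real \<Rightarrow> real \<Rightarrow> real \<Rightarrow> real \<Rightarrow> real \<Rightarrow> real \<Rightarrow> real fps" where
  "singular_part a b c d e f = fps_const a * inv_sqrt_discr ^ 3 + fps_const b * inv_sqrt_discr +
     fps_const c * (inv_sqrt_discr * discr) + fps_const d * (inv_sqrt_discr * discr\<^sup>2) +
     fps_const e * (inv_sqrt_discr * discr ^ 3) + fps_const f * (inv_sqrt_discr * discr ^ 4)"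

text \<open>The equations are the rows of the triangular matrix, with diagonal 1/16, 1/4, 1, 4, 16,
  64. As assumptions they let closed forms be put in for the new coefficients and checked by field
  arithmetic.\<close>

lemma negligible_lift_gf_singular_part:
  assumes "negligible (g - singular_part a b c d e f)"
    and coeffs: "a' = a / 16" "b' = a / 16 + b / 4" "c' = c - a / 16 - b / 4"
      "d' = 4 * d - 3 * c - a / 16" "e' = 5 * c - 20 * d + 16 * e"
      "f' = 56 * d - 7 * c - 112 * e + 64 * f"
  shows "negligible (lift_gf g - singular_part a' b' c' d' e' f')"
proof -
  let ?D = inv_sqrt_discr and ?x = discr
  have lift: "lift_gf (g - singular_part a b c d e f) = lift_gf g -
      (fps_const a * lift_gf (?D ^ 3) + fps_const b * lift_gf ?D + fps_const c * lift_gf (?D * ?x) +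
       fps_const d * lift_gf (?D * ?x\<^sup>2) + fps_const e * lift_gf (?D * ?x ^ 3) +
       fps_const f * lift_gf (?D * ?x ^ 4))"
    by (simp only: singular_part_def lift_gf_diff lift_gf_add lift_gf_const_mult)
  have D: "lift_gf ?D = fps_const (1/4) * (?D - ?D * ?x)"
  proof -
    have "?D - ?D * ?x = fps_const 4 * (fps_X * ?D)"
      by (simp add: discr_def algebra_simps numeral_fps_const)
    then show ?thesis
      by (simp add: lift_gf_inv_sqrt mult.assoc[symmetric])
  qed
  have p: "?D * (?x - 3 * ?x\<^sup>2 + 5 * ?x ^ 3 - 7 * ?x ^ 4) = ?D * ?x - fps_const 3 * (?D * ?x\<^sup>2) +
      fps_const 5 * (?D * ?x ^ 3) - fps_const 7 * (?D * ?x ^ 4)"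
    "?D * (4 * ?x\<^sup>2 - 20 * ?x ^ 3 + 56 * ?x ^ 4) = fps_const 4 * (?D * ?x\<^sup>2) -
      fps_const 20 * (?D * ?x ^ 3) + fps_const 56 * (?D * ?x ^ 4)"
    "?D * (16 * ?x ^ 3 - 112 * ?x ^ 4) = fps_const 16 * (?D * ?x ^ 3) - fps_const 112 * (?D * ?x ^ 4)"
    "?D * (64 * ?x ^ 4) = fps_const 64 * (?D * ?x ^ 4)"
    by (simp_all add: algebra_simps numeral_fps_const[symmetric])
  \<comment> \<open>The images of \<open>?D ^ 3\<close> and \<open>?D\<close> are exact, so only the
    remainder of \<open>g\<close> and the four higher terms leave errors.\<close>
  have "lift_gf g - singular_part a' b' c' d' e' f' = lift_gf (g - singular_part a b c d e f) +
      fps_const c * (lift_gf (?D * ?x) - ?D * (?x - 3 * ?x\<^sup>2 + 5 * ?x ^ 3 - 7 * ?x ^ 4)) +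
      fps_const d * (lift_gf (?D * ?x\<^sup>2) - ?D * (4 * ?x\<^sup>2 - 20 * ?x ^ 3 + 56 * ?x ^ 4)) +
      fps_const e * (lift_gf (?D * ?x ^ 3) - ?D * (16 * ?x ^ 3 - 112 * ?x ^ 4)) +
      fps_const f * (lift_gf (?D * ?x ^ 4) - ?D * (64 * ?x ^ 4))"
    unfolding lift unfolding p lift_gf_inv_sqrt_cube D singular_part_def coeffs
    by (rule fps_ext, simp only: fps_add_nth fps_sub_nth fps_mult_left_const_nth) (simp add: algebra_simps)
  then show ?thesis
    using negligible_lift_gf[OF assms(1)] negligible_lift_power_1 negligible_lift_power_2
      negligible_lift_power_3 negligible_lift_power_4
    by (simp only: negligible_add negligible_const_mult)
qed

subsection \<open>Mean and second factorial moment\<close>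

definition mean_gf :: "nat \<Rightarrow> real fps" where
  "mean_gf r = tree_gf (\<lambda>t. real (num_branches r t))"

definition fact_moment_gf :: "nat \<Rightarrow> real fps" where
  "fact_moment_gf r = tree_gf (\<lambda>t. real (num_branches r t) * (real (num_branches r t) - 1))"

lemma mean_gf_Suc: "mean_gf (Suc r) = lift_gf (mean_gf r)"
  unfolding mean_gf_def by (rule tree_gf_num_branches_Suc) simp

lemma fact_moment_gf_Suc: "fact_moment_gf (Suc r) = lift_gf (fact_moment_gf r)"
  unfolding fact_moment_gf_def
  by (rule tree_gf_num_branches_Suc[where \<phi> = "\<lambda>k. real k * (real k - 1)"]) simp

lemma mean_gf_0: "mean_gf 0 = inv_sqrt_discr"
proof (rule fps_ext)
  fix n
  have "mean_gf 0 $ n = (\<Sum>t\<in>trees n. real (n + 1))"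
    unfolding mean_gf_def tree_gf_nth by (intro sum.cong refl) (simp add: num_branches_0 trees_def)
  then show "mean_gf 0 $ n = inv_sqrt_discr $ n"
    using card_trees_eq[of n] by (simp add: mult.commute)
qed

text \<open>The coefficient \<open>n D_n\<close> equals \<open>((2 n + 1) D_n - D_n) / 2\<close>,
  and \<open>(2 n + 1) D_n\<close> is the coefficient of the cube.\<close>

lemma fact_moment_gf_0: "fact_moment_gf 0 = singular_part (1/2) (-1/2) 0 0 0 0"
proof (rule fps_ext)
  fix n
  have "fact_moment_gf 0 $ n = (\<Sum>t\<in>trees n. real (n + 1) * real n)"
    unfolding fact_moment_gf_def tree_gf_nth
    by (intro sum.cong refl) (simp add: num_branches_0 trees_def)
  also have "\<dots> = real n * (real (n + 1) * real (card (trees n)))"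
    by simp
  also have "\<dots> = real n * inv_sqrt_discr $ n"
    by (simp only: card_trees_eq)
  also have "\<dots> = singular_part (1/2) (-1/2) 0 0 0 0 $ n"
    unfolding singular_part_def fps_add_nth fps_mult_left_const_nth inv_sqrt_discr_cube_nth
    by (simp add: algebra_simps)
  finally show "fact_moment_gf 0 $ n = singular_part (1/2) (-1/2) 0 0 0 0 $ n" .
qed

lemma negligible_0: "negligible 0"
  unfolding negligible_def by (auto intro!: exI[of _ 0])

text \<open>The closed forms solve the triangular recursion started from
  \<open>inv_sqrt_discr\<close>. The last coefficient stays unspecified, as it affects the mean only
  in order \<open>n^(-3)\<close>.\<close>

lemma mean_gf_expansion:
  "\<exists>f. negligible (mean_gf r - singular_part 0 (1 / 4^r) (1 / (3 * 4^r) - 1/3)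
     (4 / (15 * 4^r) - 1/3 + 4^r / 15) (44 / (189 * 4^r) - 1/3 + 4^r / 9 - 2 * (4^r)\<^sup>2 / 189) f)"
proof (induction r)
  case 0
  have "mean_gf 0 = singular_part 0 1 0 0 0 0"
    by (simp add: mean_gf_0 singular_part_def)
  then show ?case
    by (intro exI[of _ 0]) (simp add: negligible_0)
next
  case (Suc r)
  define q :: real where "q = 4 ^ r"
  have q: "q > 0" "4 ^ Suc r = 4 * q"
    by (simp_all add: q_def)
  obtain f where "negligible (mean_gf r - singular_part 0 (1 / q) (1 / (3 * q) - 1/3)
     (4 / (15 * q) - 1/3 + q / 15) (44 / (189 * q) - 1/3 + q / 9 - 2 * q\<^sup>2 / 189) f)"
    using Suc.IH unfolding q_def by blast
  note step = negligible_lift_gf_singular_part[OF this, folded mean_gf_Suc]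
  show ?case
    unfolding q(2)
    by (rule exI, rule step[OF _ _ _ _ _ refl])
       (use q(1) in \<open>simp_all add: field_simps power2_eq_square\<close>)
qed

text \<open>The last two coefficients stay unspecified, as they contribute order
  \<open>n^(-2)\<close> at most, which is the error allowed for the variance.\<close>

lemma fact_moment_gf_expansion:
  "\<exists>e f. negligible (fact_moment_gf r - singular_part (1 / (2 * (4^r)\<^sup>2)) (- 1 / (6 * (4^r)\<^sup>2) - 1 / (3 * 4^r))
     (11/90 - 1 / (90 * (4^r)\<^sup>2) - 1 / (9 * 4^r))
     (11/90 - 1 / (1890 * (4^r)\<^sup>2) - 4 / (45 * 4^r) - 31 * 4^r / 945) e f)"
proof (induction r)
  case 0
  show ?case
    by (intro exI[of _ 0]) (simp add: negligible_0 fact_moment_gf_0)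
next
  case (Suc r)
  define q :: real where "q = 4 ^ r"
  have q: "q > 0" "4 ^ Suc r = 4 * q"
    by (simp_all add: q_def)
  obtain e f where "negligible (fact_moment_gf r - singular_part (1 / (2 * q\<^sup>2)) (- 1 / (6 * q\<^sup>2) - 1 / (3 * q))
     (11/90 - 1 / (90 * q\<^sup>2) - 1 / (9 * q)) (11/90 - 1 / (1890 * q\<^sup>2) - 4 / (45 * q) - 31 * q / 945) e f)"
    using Suc.IH unfolding q_def by blast
  note step = negligible_lift_gf_singular_part[OF this, folded fact_moment_gf_Suc]
  show ?case
    unfolding q(2)
    by (rule exI, rule exI, rule step[OF _ _ _ _ refl refl])
       (use q(1) in \<open>simp_all add: field_simps power2_eq_square\<close>)
qed

subsection \<open>Asymptotics\<close>

text \<open>Division by the Catalan number costs two powers of \<open>n\<close>: one from the factor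
  \<open>n + 1\<close> and one from the crude lower bound on \<open>inv_sqrt_discr\<close>. This
  leaves \<open>n^(-3)\<close> out of \<open>n^(-5)\<close>.\<close>

lemma negligible_average_bigo:
  assumes "negligible h"
  shows "(\<lambda>n. h $ n * real (n + 1) / inv_sqrt_discr $ n) \<in> O(\<lambda>n. 1 / real n ^ 3)"
proof -
  obtain K where K: "\<And>n. \<bar>h $ n\<bar> * real (n + 1) ^ 5 \<le> K * 4 ^ n"
    using assms unfolding negligible_def by blast
  have K0: "K \<ge> 0"
    using K[of 0] order_trans[OF abs_ge_zero, of "h $ 0" K] by simp
  have "\<bar>h $ n * real (n + 1) / inv_sqrt_discr $ n\<bar> \<le> 2 * K * (1 / real n ^ 3)" if "n > 0" for n
  proof -
    define D where "D = inv_sqrt_discr $ n"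
    have D: "D > 0" "4 ^ n \<le> (2 * real n + 1) * D"
      using inv_sqrt_discr_nth_pos inv_sqrt_discr_nth_ge by (simp_all add: D_def)
    have "\<bar>h $ n\<bar> * real (n + 1) * real (n + 1) ^ 4 \<le> K * 4 ^ n"
      using K[of n] by (simp add: eval_nat_numeral mult_ac)
    also have "\<dots> \<le> K * ((2 * real (n + 1)) * D)"
      using K0 D order_trans[OF D(2), of "(2 * real (n + 1)) * D"] by (intro mult_left_mono) auto
    finally have "(\<bar>h $ n\<bar> * real (n + 1)) * real (n + 1) ^ 3 * real (n + 1) \<le> (2 * K * D) * real (n + 1)"
      by (simp add: eval_nat_numeral mult_ac)
    then have "(\<bar>h $ n\<bar> * real (n + 1)) * real (n + 1) ^ 3 \<le> 2 * K * D"
      by (rule mult_right_le_imp_le) simp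
    moreover have "(\<bar>h $ n\<bar> * real (n + 1)) * real n ^ 3 \<le> (\<bar>h $ n\<bar> * real (n + 1)) * real (n + 1) ^ 3"
      by (intro mult_left_mono power_mono) auto
    ultimately have "(\<bar>h $ n\<bar> * real (n + 1)) * real n ^ 3 \<le> 2 * K * D"
      by linarith
    then have "\<bar>h $ n\<bar> * real (n + 1) / D \<le> 2 * K * (1 / real n ^ 3)"
      using that D(1) by (simp add: field_simps)
    then show ?thesis
      using D(1) unfolding D_def[symmetric] by (simp add: abs_mult)
  qed
  then show ?thesis
    by (intro bigoI[of _ "2 * K"] eventually_mono[OF eventually_gt_at_top[of 0]]) simp
qed

text \<open>The ratios of successive coefficients multiply up to the denominators, whose factors are
  odd integers and hence nonzero for every \<open>n\<close>.\<close>

lemma singular_part_average: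
  "singular_part a b c d e f $ n * real (n + 1) / inv_sqrt_discr $ n =
     a * ((2 * real n + 1) * (real n + 1)) + b * (real n + 1) + c * ((real n + 1) / (1 - 2 * real n))
     + d * (3 * (real n + 1) / ((1 - 2 * real n) * (3 - 2 * real n)))
     + e * (15 * (real n + 1) / ((1 - 2 * real n) * (3 - 2 * real n) * (5 - 2 * real n)))
     + f * (105 * (real n + 1) / ((1 - 2 * real n) * (3 - 2 * real n) * (5 - 2 * real n) * (7 - 2 * real n)))"
proof -
  define D where "D = inv_sqrt_discr $ n"
  have D: "D \<noteq> 0"
    using inv_sqrt_discr_nth_pos[of n] by (simp add: D_def)
  have odd: "real k - 2 * real n \<noteq> 0" if "odd k" for k
  proof
    assume "real k - 2 * real n = 0"
    then have "real k = real (2 * n)"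
      by simp
    then have "k = 2 * n"
      by (simp only: of_nat_eq_iff)
    with that show False
      by simp
  qed
  have ratio: "(inv_sqrt_discr * discr ^ Suc i) $ n =
      (2 * real i + 1) * (inv_sqrt_discr * discr ^ i) $ n / (2 * real i + 1 - 2 * real n)" for i
    using inv_sqrt_discr_power_nth[of i n] odd[of "2 * i + 1"] by (simp add: eq_divide_eq)
  have 1: "(inv_sqrt_discr * discr) $ n = D / (1 - 2 * real n)"
    using ratio[of 0] by (simp add: D_def)
  have 2: "(inv_sqrt_discr * discr\<^sup>2) $ n = 3 * D / ((1 - 2 * real n) * (3 - 2 * real n))"
    using ratio[of 1, folded numeral_2_eq_2[unfolded One_nat_def[symmetric]]] 1 by simp
  have 3: "(inv_sqrt_discr * discr ^ 3) $ n = 15 * D / ((1 - 2 * real n) * (3 - 2 * real n) * (5 - 2 * real n))"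
    using ratio[of 2] unfolding 2 by (simp del: power_Suc add: mult_ac)
  have 4: "(inv_sqrt_discr * discr ^ 4) $ n =
      105 * D / ((1 - 2 * real n) * (3 - 2 * real n) * (5 - 2 * real n) * (7 - 2 * real n))"
    using ratio[of 3] unfolding 3 by (simp del: power_Suc add: mult_ac)
  show ?thesis
    unfolding singular_part_def fps_add_nth fps_mult_left_const_nth 1 2 3 4 inv_sqrt_discr_cube_nth D_def[symmetric]
  proof -
    have "(a * (u * D) + b * D + c * (D / w1) + d * (3 * D / w2) + e * (15 * D / w3) + f * (105 * D / w4)) * m / D =
        a * (u * m) + b * m + c * (m / w1) + d * (3 * m / w2) + e * (15 * m / w3) + f * (105 * m / w4)"
      for u w1 w2 w3 w4 m
    proof -
      have "(a * (u * D) + b * D + c * (D / w1) + d * (3 * D / w2) + e * (15 * D / w3) + f * (105 * D / w4)) * m =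
          D * (a * (u * m) + b * m + c * (m / w1) + d * (3 * m / w2) + e * (15 * m / w3) + f * (105 * m / w4))"
        by (simp add: distrib_left distrib_right mult_ac)
      then show ?thesis
        using D by simp
    qed
    then show "(a * ((2 * real n + 1) * D) + b * D + c * (D / (1 - 2 * real n)) +
        d * (3 * D / ((1 - 2 * real n) * (3 - 2 * real n))) +
        e * (15 * D / ((1 - 2 * real n) * (3 - 2 * real n) * (5 - 2 * real n))) +
        f * (105 * D / ((1 - 2 * real n) * (3 - 2 * real n) * (5 - 2 * real n) * (7 - 2 * real n)))) *
        real (n + 1) / D =
      a * ((2 * real n + 1) * (real n + 1)) + b * (real n + 1) + c * ((real n + 1) / (1 - 2 * real n))
       + d * (3 * (real n + 1) / ((1 - 2 * real n) * (3 - 2 * real n)))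
       + e * (15 * (real n + 1) / ((1 - 2 * real n) * (3 - 2 * real n) * (5 - 2 * real n)))
       + f * (105 * (real n + 1) / ((1 - 2 * real n) * (3 - 2 * real n) * (5 - 2 * real n) * (7 - 2 * real n)))"
      by (simp only: of_nat_add of_nat_1)
  qed
qed

section \<open>Mean and variance as coefficient quotients and their expansions\<close>

lemma average_eq: "(\<Sum>t\<in>trees n. w t) / real (card (trees n)) = tree_gf w $ n * real (n + 1) / inv_sqrt_discr $ n"
  unfolding card_trees_eq[of n, symmetric] tree_gf_nth by simp

lemma E_branches_eq: "E_branches n r = mean_gf r $ n * real (n + 1) / inv_sqrt_discr $ n"
  unfolding E_branches_def mean_gf_def by (rule average_eq)

lemma V_branches_eq:
  "V_branches n r = fact_moment_gf r $ n * real (n + 1) / inv_sqrt_discr $ n + E_branches n r - (E_branches n r)\<^sup>2"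
proof -
  define N where "N = real (card (trees n))"
  define E where "E = E_branches n r"
  define X where "X = (\<lambda>t. real (num_branches r t))"
  have N: "N \<noteq> 0"
    using card_trees_eq[of n] inv_sqrt_discr_nth_pos[of n] by (auto simp: N_def)
  have "(\<Sum>t\<in>trees n. (X t - E)\<^sup>2) = (\<Sum>t\<in>trees n. X t * (X t - 1) + (1 - 2 * E) * X t + E\<^sup>2)"
    by (intro sum.cong refl) (simp add: power2_eq_square algebra_simps)
  also have "\<dots> = (\<Sum>t\<in>trees n. X t * (X t - 1)) + (1 - 2 * E) * (\<Sum>t\<in>trees n. X t) + N * E\<^sup>2"
    by (simp add: sum.distrib sum_distrib_left N_def)
  also have "(\<Sum>t\<in>trees n. X t) = N * E"
    using N by (simp add: E_def E_branches_def X_def N_def)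
  finally have "V_branches n r = (\<Sum>t\<in>trees n. X t * (X t - 1)) / N + E - E\<^sup>2"
    using N unfolding V_branches_def E_def[symmetric] X_def[symmetric] N_def[symmetric]
    by (simp add: X_def field_simps power2_eq_square)
  also have "(\<Sum>t\<in>trees n. X t * (X t - 1)) / N = fact_moment_gf r $ n * real (n + 1) / inv_sqrt_discr $ n"
    unfolding N_def fact_moment_gf_def X_def by (rule average_eq)
  finally show ?thesis
    by (simp only: E_def)
qed

text \<open>The two polynomial terms are kept exactly, the next three are expanded up to
  \<open>n^(-2)\<close>, and the term with \<open>f\<close> is already
  \<open>O(n^(-3))\<close>.\<close>

lemma average_asymptotics:
  assumes "negligible (g - singular_part a b c d e f)"
  shows "(\<lambda>n. g $ n * real (n + 1) / inv_sqrt_discr $ n -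
      (a * ((2 * real n + 1) * (real n + 1)) + b * (real n + 1)
       + c * (- 1/2 - 3 / (4 * real n) - 3 / (8 * real n ^ 2))
       + d * (3 / (4 * real n) + 9 / (4 * real n ^ 2)) + e * (- 15 / (8 * real n ^ 2))))
    \<in> O(\<lambda>n. 1 / real n ^ 3)"
proof -
  define h where "h = g - singular_part a b c d e f"
  have h: "(\<lambda>n. h $ n * real (n + 1) / inv_sqrt_discr $ n) \<in> O(\<lambda>n. 1 / real n ^ 3)"
    using assms unfolding h_def by (rule negligible_average_bigo)
  have 1: "(\<lambda>n. (real n + 1) / (1 - 2 * real n) - (- 1/2 - 3 / (4 * real n) - 3 / (8 * real n ^ 2)))
      \<in> O(\<lambda>n. 1 / real n ^ 3)"
    by real_asymp
  have 2: "(\<lambda>n. 3 * (real n + 1) / ((1 - 2 * real n) * (3 - 2 * real n)) - (3 / (4 * real n) + 9 / (4 * real n ^ 2)))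
      \<in> O(\<lambda>n. 1 / real n ^ 3)"
    by real_asymp
  have 3: "(\<lambda>n. 15 * (real n + 1) / ((1 - 2 * real n) * (3 - 2 * real n) * (5 - 2 * real n)) - (- 15 / (8 * real n ^ 2)))
      \<in> O(\<lambda>n. 1 / real n ^ 3)"
    by real_asymp
  have 4: "(\<lambda>n. 105 * (real n + 1) / ((1 - 2 * real n) * (3 - 2 * real n) * (5 - 2 * real n) * (7 - 2 * real n)))
      \<in> O(\<lambda>n. 1 / real n ^ 3)"
    by real_asymp
  have g: "g $ n * real (n + 1) / inv_sqrt_discr $ n =
      h $ n * real (n + 1) / inv_sqrt_discr $ n + singular_part a b c d e f $ n * real (n + 1) / inv_sqrt_discr $ n" for n
    by (simp add: h_def add_divide_distrib[symmetric] distrib_right[symmetric])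
  have scale: "(\<lambda>n. k * u n) \<in> O(w)" if "u \<in> O(w)" for k :: real and u w :: "nat \<Rightarrow> real"
    using that by simp
  note sum = sum_in_bigo(1)[OF sum_in_bigo(1)[OF sum_in_bigo(1)[OF sum_in_bigo(1)[OF h
    scale[OF 1, of c]] scale[OF 2, of d]] scale[OF 3, of e]] scale[OF 4, of f]]
  show ?thesis
    unfolding g singular_part_average
    by (rule landau_o.big.in_cong[THEN iffD1, OF _ sum], rule always_eventually) (simp add: algebra_simps)
qed

text \<open>The leading term \<open>A\<^sup>2 n^2\<close> cancels against the square of the mean.
  Squaring multiplies the error of \<open>E\<close> by the order \<open>n\<close> of
  \<open>E\<close>, which is why \<open>E\<close> is required up to \<open>n^(-3)\<close> for an
  error \<open>n^(-2)\<close> here.\<close>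

lemma variance_asymptotics:
  fixes E F V :: "nat \<Rightarrow> real"
  assumes E: "(\<lambda>n. E n - (A * real n + B + C / real n + G / real n ^ 2)) \<in> O(\<lambda>n. 1 / real n ^ 3)"
    and F: "(\<lambda>n. F n - (A\<^sup>2 * real n ^ 2 + P * real n + Q + R / real n + S / real n ^ 2)) \<in> O(\<lambda>n. 1 / real n ^ 3)"
    and V: "\<And>n. V n = F n + E n - (E n)\<^sup>2"
  shows "(\<lambda>n. V n - ((P + A - 2 * A * B) * real n + (Q + B - B\<^sup>2 - 2 * A * C) +
      (R + C - 2 * A * G - 2 * B * C) / real n)) \<in> O(\<lambda>n. 1 / real n ^ 2)"
proof -
  define e where "e = (\<lambda>n. A * real n + B + C / real n + G / real n ^ 2)"
  define \<phi> where "\<phi> = (\<lambda>n. A\<^sup>2 * real n ^ 2 + P * real n + Q + R / real n + S / real n ^ 2)"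
  have scale: "(\<lambda>n. k * u n) \<in> O(w)" if "u \<in> O(w)" for k :: real and u w :: "nat \<Rightarrow> real"
    using that by simp
  have le: "(\<lambda>n. 1 / real n ^ 3) \<in> O(\<lambda>n. 1 / real n ^ 2)" "(\<lambda>n. 1 / real n ^ 3) \<in> O(\<lambda>n. real n)"
    by real_asymp+
  have Ee: "(\<lambda>n. E n - e n) \<in> O(\<lambda>n. 1 / real n ^ 3)" and F\<phi>: "(\<lambda>n. F n - \<phi> n) \<in> O(\<lambda>n. 1 / real n ^ 3)"
    using E F by (simp_all add: e_def \<phi>_def)
  have mono: "(\<lambda>n. real n) \<in> O(\<lambda>n. real n)" "(\<lambda>n. 1) \<in> O(\<lambda>n. real n)"
    "(\<lambda>n. 1 / real n) \<in> O(\<lambda>n. real n)" "(\<lambda>n. 1 / real n ^ 2) \<in> O(\<lambda>n. real n)"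
    by real_asymp+
  have "(\<lambda>n. A * real n + B * 1 + C * (1 / real n) + G * (1 / real n ^ 2)) \<in> O(\<lambda>n. real n)"
    by (intro sum_in_bigo scale mono)
  then have e: "e \<in> O(\<lambda>n. real n)"
    by (simp add: e_def)
  \<comment> \<open>This is \<open>E + e\<close>, the cofactor in
    \<open>E^2 - e^2 = (E - e) (E + e)\<close>, written through quantities with known
    bounds.\<close>
  have "(\<lambda>n. (E n - e n) + (e n + e n)) \<in> O(\<lambda>n. real n)"
    by (intro sum_in_bigo e landau_o.big_trans[OF Ee le(2)])
  from landau_o.big.mult[OF Ee this]
  have "(\<lambda>n. (E n - e n) * ((E n - e n) + (e n + e n))) \<in> O(\<lambda>n. 1 / real n ^ 3 * real n)" .
  also have "(\<lambda>n. 1 / real n ^ 3 * real n) \<in> O(\<lambda>n. 1 / real n ^ 2)"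
    by real_asymp
  finally have sq: "(\<lambda>n. (E n - e n) * ((E n - e n) + (e n + e n))) \<in> O(\<lambda>n. 1 / real n ^ 2)" .
  \<comment> \<open>These are the terms of order \<open>n^(-2)\<close> and lower in
    \<open>\<phi> + e - e^2\<close>.\<close>
  have tail: "(\<lambda>n. (S + G - C\<^sup>2 - 2 * B * G) * (1 / real n ^ 2) + (- 2 * C * G) * (1 / real n ^ 3)
      + (- (G\<^sup>2)) * (1 / real n ^ 4)) \<in> O(\<lambda>n. 1 / real n ^ 2)"
    by (intro sum_in_bigo scale) real_asymp+
  have "(\<lambda>n. (F n - \<phi> n) + (E n - e n) - (E n - e n) * ((E n - e n) + (e n + e n)) +
      ((S + G - C\<^sup>2 - 2 * B * G) * (1 / real n ^ 2) + (- 2 * C * G) * (1 / real n ^ 3)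
      + (- (G\<^sup>2)) * (1 / real n ^ 4))) \<in> O(\<lambda>n. 1 / real n ^ 2)"
    by (intro sum_in_bigo sq tail landau_o.big_trans[OF Ee le(1)] landau_o.big_trans[OF F\<phi> le(1)])
  then show ?thesis
  proof (rule landau_o.big.in_cong[THEN iffD1, rotated], intro eventually_mono[OF eventually_gt_at_top[of 0]])
    fix n :: nat assume "n > 0"
    \<comment> \<open>With \<open>i\<close> for the reciprocal, the claim is a polynomial identity
      modulo \<open>n i = 1\<close>.\<close>
    define i where "i = 1 / real n"
    have i: "real n * i = 1"
      using \<open>n > 0\<close> by (simp add: i_def)
    have inv: "k / real n = k * i" "k / real n ^ 2 = k * i\<^sup>2" "k / real n ^ 3 = k * i ^ 3" "k / real n ^ 4 = k * i ^ 4" for k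
      by (simp_all add: i_def power_divide)
    show "(F n - \<phi> n) + (E n - e n) - (E n - e n) * ((E n - e n) + (e n + e n)) +
      ((S + G - C\<^sup>2 - 2 * B * G) * (1 / real n ^ 2) + (- 2 * C * G) * (1 / real n ^ 3)
      + (- (G\<^sup>2)) * (1 / real n ^ 4)) = V n - ((P + A - 2 * A * B) * real n + (Q + B - B\<^sup>2 - 2 * A * C) +
      (R + C - 2 * A * G - 2 * B * C) / real n)"
      unfolding V e_def \<phi>_def inv using i by algebra
  qed
qed

theorem theorem1:
  fixes r :: nat
  shows "((\<lambda>n. E_branches n r
            - (real n / 4^r + (1/6) * (1 + 5 / 4^r)
               + (1 / (20 * real n)) * (4^r - 1 / 4^r)
               + (1 / (12 * real n ^ 2)) * (5 * 16^r / 21 - 7 * 4^r / 10 + 97 / (210 * 4^r))))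
         \<in> O(\<lambda>n. 1 / real n ^ 3))
       \<and> ((\<lambda>n. V_branches n r
            - ((4^r - 1) / (3 * 16^r) * real n
               - (2 * 16^r - 25 * 4^r + 23) / (90 * 16^r)
               - (13 * 64^r - 14 * 16^r + 7 * 4^r - 6) / (420 * 16^r * real n)))
         \<in> O(\<lambda>n. 1 / real n ^ 2))"
proof -
  \<comment> \<open>Writing \<open>16^r = q^2\<close> and \<open>64^r = q^3\<close> makes all
    coefficients rational functions of \<open>q\<close>.\<close>
  define q :: real where "q = 4 ^ r"
  have q: "q > 0" "(16::real) ^ r = q\<^sup>2" "(64::real) ^ r = q ^ 3"
    by (simp_all add: q_def power2_eq_square power3_eq_cube flip: power_mult_distrib)
  define A B C G where "A = 1 / q" and "B = (1/6) * (1 + 5 / q)" and "C = (1/20) * (q - 1 / q)"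
    and "G = (1/12) * (5 * q\<^sup>2 / 21 - 7 * q / 10 + 97 / (210 * q))"
  note ABCG = A_def B_def C_def G_def
  obtain f where f: "negligible (mean_gf r - singular_part 0 (1 / q) (1 / (3 * q) - 1/3)
     (4 / (15 * q) - 1/3 + q / 15) (44 / (189 * q) - 1/3 + q / 9 - 2 * q\<^sup>2 / 189) f)"
    using mean_gf_expansion[of r] unfolding q_def by blast
  have E: "(\<lambda>n. E_branches n r - (A * real n + B + C / real n + G / real n ^ 2)) \<in> O(\<lambda>n. 1 / real n ^ 3)"
    using average_asymptotics[OF f]
  proof (rule landau_o.big.in_cong[THEN iffD1, rotated], intro eventually_mono[OF eventually_gt_at_top[of 0]])
    fix n :: nat assume "n > 0"
    then show "mean_gf r $ n * real (n + 1) / inv_sqrt_discr $ n -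
        (0 * ((2 * real n + 1) * (real n + 1)) + 1 / q * (real n + 1)
         + (1 / (3 * q) - 1/3) * (- 1/2 - 3 / (4 * real n) - 3 / (8 * real n ^ 2))
         + (4 / (15 * q) - 1/3 + q / 15) * (3 / (4 * real n) + 9 / (4 * real n ^ 2))
         + (44 / (189 * q) - 1/3 + q / 9 - 2 * q\<^sup>2 / 189) * (- 15 / (8 * real n ^ 2))) =
        E_branches n r - (A * real n + B + C / real n + G / real n ^ 2)"
      unfolding E_branches_eq ABCG using q(1) by (simp add: field_simps power2_eq_square)
  qed
  define b c d where "b = - 1 / (6 * q\<^sup>2) - 1 / (3 * q)" and "c = 11/90 - 1 / (90 * q\<^sup>2) - 1 / (9 * q)"
    and "d = 11/90 - 1 / (1890 * q\<^sup>2) - 4 / (45 * q) - 31 * q / 945"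
  \<comment> \<open>The coefficients of \<open>n\<close>, 1 and \<open>1/n\<close> in the averaged
    singular part; the coefficient of \<open>n^2\<close> is \<open>1/q^2\<close>, the square of
    \<open>A\<close>.\<close>
  define P Q R where "P = 3 / (2 * q\<^sup>2) + b" and "Q = 1 / (2 * q\<^sup>2) + b - c / 2" and "R = (3/4) * (d - c)"
  obtain e f where ef: "negligible (fact_moment_gf r - singular_part (1 / (2 * q\<^sup>2)) b c d e f)"
    using fact_moment_gf_expansion[of r] unfolding q_def b_def c_def d_def by blast
  \<comment> \<open>\<open>S\<close> depends on the unspecified \<open>e\<close>, hence it is only
    obtained.\<close>
  obtain S where F: "(\<lambda>n. fact_moment_gf r $ n * real (n + 1) / inv_sqrt_discr $ n -
      (A\<^sup>2 * real n ^ 2 + P * real n + Q + R / real n + S / real n ^ 2)) \<in> O(\<lambda>n. 1 / real n ^ 3)"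
  proof
    have eq: "1 / (2 * q\<^sup>2) * ((2 * real n + 1) * (real n + 1)) + b * (real n + 1)
         + c * (- 1/2 - 3 / (4 * real n) - 3 / (8 * real n ^ 2))
         + d * (3 / (4 * real n) + 9 / (4 * real n ^ 2)) + e * (- 15 / (8 * real n ^ 2)) =
        A\<^sup>2 * real n ^ 2 + P * real n + Q + R / real n + (- (3/8) * c + 9/4 * d - 15/8 * e) / real n ^ 2" for n
    proof -
      define i j where "i = 1 / real n" and "j = 1 / q\<^sup>2"
      have ij: "k / real n = k * i" "k / real n ^ 2 = k * i\<^sup>2" "k / (l * real n) = k / l * i"
          "k / (l * real n ^ 2) = k / l * i\<^sup>2" "k / (l * q\<^sup>2) = k / l * j" "A\<^sup>2 = j" for k l
        by (simp_all add: i_def j_def A_def power_divide)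
      show ?thesis
        unfolding P_def Q_def R_def ij by (simp add: power2_eq_square field_simps)
    qed
    show "(\<lambda>n. fact_moment_gf r $ n * real (n + 1) / inv_sqrt_discr $ n -
        (A\<^sup>2 * real n ^ 2 + P * real n + Q + R / real n + (- (3/8) * c + 9/4 * d - 15/8 * e) / real n ^ 2))
        \<in> O(\<lambda>n. 1 / real n ^ 3)"
      using average_asymptotics[OF ef] unfolding eq .
  qed
  have coeffs: "P + A - 2 * A * B = (q - 1) / (3 * q\<^sup>2)"
    "Q + B - B\<^sup>2 - 2 * A * C = - ((2 * q\<^sup>2 - 25 * q + 23) / (90 * q\<^sup>2))"
    "R + C - 2 * A * G - 2 * B * C = - ((13 * q ^ 3 - 14 * q\<^sup>2 + 7 * q - 6) / (420 * q\<^sup>2))"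
    unfolding P_def Q_def R_def b_def c_def d_def ABCG using q(1)
    by (simp_all add: field_simps power2_eq_square power3_eq_cube)
  have "(\<lambda>n. V_branches n r - ((P + A - 2 * A * B) * real n + (Q + B - B\<^sup>2 - 2 * A * C) +
      (R + C - 2 * A * G - 2 * B * C) / real n)) \<in> O(\<lambda>n. 1 / real n ^ 2)"
    using E F V_branches_eq by (rule variance_asymptotics)
  then have V: "(\<lambda>n. V_branches n r - ((q - 1) / (3 * q\<^sup>2) * real n - (2 * q\<^sup>2 - 25 * q + 23) / (90 * q\<^sup>2) -
      (13 * q ^ 3 - 14 * q\<^sup>2 + 7 * q - 6) / (420 * q\<^sup>2 * real n))) \<in> O(\<lambda>n. 1 / real n ^ 2)"
    unfolding coeffs by (simp only: minus_divide_left[symmetric] divide_divide_eq_left add_uminus_conv_diff)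
  show ?thesis
    using E V unfolding ABCG q(2,3) q_def[symmetric] by (simp add: mult.commute)
qed

end
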